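(* Let $\beta\equiv\beta^{(2n)}=\{\beta_i\}_{i\in\mathbb{Z}_+^N,\,|i|\le 2n}$ be an $N$-dimensional real sequence, let $\mathcal{Q}\equiv\{q_i\}_{i=1}^m\subseteq\mathbb{R}[t_1,\dots,t_N]$ with $\deg q_i=2k_i$ or $2k_i-1$ $(1\le i\le m)$, and let $K_{\mathcal{Q}}:=\{t\in\mathbb{R}^N:q_i(t)\ge0,\ 1\le i\le m\}$. Then $\beta$ has a finitely atomic representing measure supported in $K_{\mathcal{Q}}$ if and only if $\mathcal{M}(n)(\beta)$ admits some positive semidefinite moment matrix extension $\mathcal{M}(n+j)$, with $0\le j\le 2\binom{2n+N}{N}-n$, which in turn admits a flat extension $\mathcal{M}(n+j+1)$ for which $\mathcal{M}_{q_i}(n+j+k_i)\ge 0$ $(1\le i\le m)$.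
   Context: For $i\in\mathbb{Z}_+^N$, $|i|=i_1+\dots+i_N$ and $t^i=t_1^{i_1}\cdots t_N^{i_N}$. A representing measure for $\beta^{(2n)}$ is a positive Borel measure $\mu$ on $\mathbb{R}^N$ with $\beta_i=\int t^i\,d\mu$ (convergent) for all $|i|\le 2n$; finitely atomic means $\mu$ is a finite positive combination of point masses. The moment matrix $\mathcal{M}(n)(\beta)$ has rows and columns indexed by $\{i\in\mathbb{Z}_+^N:|i|\le n\}$ with entry $\beta_{i+j}$ in row $i$, column $j$. A moment matrix extension $\mathcal{M}(n+j)$ of $\mathcal{M}(n)(\beta)$ is a moment matrix of a real sequence of degree $2(n+j)$ extending $\beta$ (for $j=0$ it is $\mathcal{M}(n)$ itself). A flat extension $\mathcal{M}(l+1)$ of a moment matrix $\mathcal{M}(l)$ is a moment matrix extension with $\operatorname{rank}\mathcal{M}(l+1)=\operatorname{rank}\mathcal{M}(l)$. $A\ge0$ means positive semidefinite. If $\mathcal{M}(l)\ge0$ has a flat extension $\mathcal{M}(l+1)$, then $\mathcal{M}(l+1)$ has unique successive flat moment matrix extensions $\mathcal{M}(l+2),\mathcal{M}(l+3),\dots$. Let $\tilde\beta$ be the resulting full moment sequence and $\Lambda_{\tilde\beta}$ the linear functional on polynomials with $\Lambda_{\tilde\beta}(t^i)=\tilde\beta_i$. For $q$ with $\deg q=2k$ or $2k-1$, the localizing matrix $\mathcal{M}_q(l+k)$ (relative to $\mathcal{M}(l+k)$) is the matrix with rows and columns indexed by $\{i\in\mathbb{Z}_+^N:|i|\le l\}$,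 uniquely determined by $\langle \mathcal{M}_q(l+k)\hat f,\hat g\rangle=\Lambda_{\tilde\beta}(qf\bar g)$ for all complex polynomials $f,g$ in $t$ of degree at most $l$, where $\hat f$ is the coefficient vector of $f$ with respect to the monomials. In the statement this is applied with $l=n+j$, using $\mathcal{M}(n+j+1)$ and its unique successive flat extensions. *)

theory Defs
  imports "HOL-Analysis.Analysis" "HOL-Analysis.Finite_Function_Topology"
begin

section \<open>Multi-indices and polynomials\<close>

text \<open>
  A multi-index is a vector of type \<open>nat ^ 'n\<close> with \<open>N = CARD('n)\<close>, and a polynomial in the
  variables \<open>t $ k\<close> is a finitely supported map from multi-indices to coefficients; sum, product
  and coefficient extraction are those of \<^theory>\<open>HOL-Library.Poly_Mapping\<close>.
\<close>

type_synonym ('n, 'a) mpoly = "nat ^ 'n \<Rightarrow>\<^sub>0 'a"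

definition idx_deg :: "nat ^ 'n::finite \<Rightarrow> nat" where
  "idx_deg i = (\<Sum>k\<in>UNIV. i $ k)"

definition idx_le :: "nat \<Rightarrow> (nat ^ 'n::finite) set" where
  "idx_le d = {i. idx_deg i \<le> d}"

definition idx_pow :: "real ^ 'n::finite \<Rightarrow> nat ^ 'n \<Rightarrow> real" where
  "idx_pow t i = (\<Prod>k\<in>UNIV. (t $ k) ^ (i $ k))"

text \<open>The zero polynomial has degree 0.\<close>

definition mpoly_deg :: "('n::finite, 'a::zero) mpoly \<Rightarrow> nat" where
  "mpoly_deg p = Max (insert 0 (idx_deg ` Poly_Mapping.keys p))"

definition mpoly_eval :: "('n::finite, real) mpoly \<Rightarrow> real ^ 'n \<Rightarrow> real" where
  "mpoly_eval p t = (\<Sum>i\<in>Poly_Mapping.keys p. Poly_Mapping.lookup p i * idx_pow t i)"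

text \<open>\<open>K\<^sub>Q\<close> for the family \<open>q 1, \<dots>, q m\<close>.\<close>

definition K_set :: "nat \<Rightarrow> (nat \<Rightarrow> ('n::finite, real) mpoly) \<Rightarrow> (real ^ 'n) set" where
  "K_set m q = {t. \<forall>i\<in>{1..m}. mpoly_eval (q i) t \<ge> 0}"


section \<open>Representing measures\<close>

text \<open>
  A sequence of degree \<open>d\<close> is a function on all multi-indices of which only the values at \<open>i\<close> with
  \<open>|i| \<le> d\<close> are ever used.
\<close>

definition representing_measure ::
    "nat \<Rightarrow> (nat ^ 'n::finite \<Rightarrow> real) \<Rightarrow> (real ^ 'n) measure \<Rightarrow> bool" where
  "representing_measure d \<beta> \<mu> \<longleftrightarrow>
     sets \<mu> = sets borel \<and>
     (\<forall>i\<in>idx_le d. integrable \<mu> (\<lambda>t. idx_pow t i) \<and> \<beta> i = (\<integral>t. idx_pow t i \<partial>\<mu>))"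

text \<open>The empty combination, i.e. the zero measure, is allowed.\<close>

definition finitely_atomic :: "(real ^ 'n::finite) measure \<Rightarrow> bool" where
  "finitely_atomic \<mu> \<longleftrightarrow>
     (\<exists>S \<rho>. finite S \<and> (\<forall>x\<in>S. (0::real) < \<rho> x) \<and>
        (\<forall>A\<in>sets borel. emeasure \<mu> A = (\<Sum>x\<in>S. ennreal (\<rho> x) * indicator A x)))"

definition measure_supp :: "(real ^ 'n::finite) measure \<Rightarrow> (real ^ 'n) set" where
  "measure_supp \<mu> = {x. \<forall>U. open U \<longrightarrow> x \<in> U \<longrightarrow> emeasure \<mu> U > 0}"


section \<open>Matrices indexed by a finite set\<close>

text \<open>
  A real matrix with rows and columns indexed by the finite set \<open>I\<close> is a function
  \<open>A :: 'i \<Rightarrow> 'i \<Rightarrow> real\<close>, row index first, considered together with \<open>I\<close>.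
\<close>

definition mat_psd :: "'i set \<Rightarrow> ('i \<Rightarrow> 'i \<Rightarrow> real) \<Rightarrow> bool" where
  "mat_psd I A \<longleftrightarrow>
     (\<forall>i\<in>I. \<forall>j\<in>I. A i j = A j i) \<and>
     (\<forall>x. 0 \<le> (\<Sum>i\<in>I. \<Sum>j\<in>I. A i j * x j * x i))"

definition mat_col :: "'i set \<Rightarrow> ('i \<Rightarrow> 'i \<Rightarrow> real) \<Rightarrow> 'i \<Rightarrow> ('i \<Rightarrow>\<^sub>0 real)" where
  "mat_col I A j = (\<Sum>i\<in>I. Poly_Mapping.single i (A i j))"

text \<open>Since \<^term>\<open>dim\<close> is the dimension of the linear span, this is the column rank.\<close>

definition mat_rank :: "'i set \<Rightarrow> ('i \<Rightarrow> 'i \<Rightarrow> real) \<Rightarrow> nat" where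
  "mat_rank I A = dim (mat_col I A ` I)"


section \<open>Moment matrices and their extensions\<close>

text \<open>\<open>M(l)(\<beta>)\<close>, indexed by \<^term>\<open>idx_le l\<close>; it involves the values of \<open>\<beta>\<close> up to degree \<open>2l\<close>.\<close>

definition moment_matrix ::
    "nat \<Rightarrow> (nat ^ 'n::finite \<Rightarrow> real) \<Rightarrow> nat ^ 'n \<Rightarrow> nat ^ 'n \<Rightarrow> real" where
  "moment_matrix l \<beta> i j = (if i \<in> idx_le l \<and> j \<in> idx_le l then \<beta> (i + j) else 0)"

abbreviation moment_rank :: "nat \<Rightarrow> (nat ^ 'n::finite \<Rightarrow> real) \<Rightarrow> nat" where
  "moment_rank l \<beta> \<equiv> mat_rank (idx_le l) (moment_matrix l \<beta>)"

text \<open>\<open>M(r)(\<gamma>)\<close> is a moment matrix extension of \<open>M(l)(\<beta>)\<close>.\<close>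

definition moment_extension ::
    "nat \<Rightarrow> (nat ^ 'n::finite \<Rightarrow> real) \<Rightarrow> nat \<Rightarrow> (nat ^ 'n \<Rightarrow> real) \<Rightarrow> bool" where
  "moment_extension l \<beta> r \<gamma> \<longleftrightarrow> l \<le> r \<and> (\<forall>i\<in>idx_le (2 * l). \<gamma> i = \<beta> i)"

text \<open>\<open>M(l + 1)(\<delta>)\<close> is a flat extension of \<open>M(l)(\<gamma>)\<close>.\<close>

definition flat_extension ::
    "nat \<Rightarrow> (nat ^ 'n::finite \<Rightarrow> real) \<Rightarrow> (nat ^ 'n \<Rightarrow> real) \<Rightarrow> bool" where
  "flat_extension l \<gamma> \<delta> \<longleftrightarrow>
     moment_extension l \<gamma> (l + 1) \<delta> \<and> moment_rank (l + 1) \<delta> = moment_rank l \<gamma>"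

text \<open>
  The full moment sequence of the unique successive flat extensions \<open>M(r + 1), M(r + 2), \<dots>\<close> of
  \<open>M(r)(\<delta>)\<close>.  Only meaningful if these exist and are unique, in particular if \<open>M(r)(\<delta>)\<close> is a flat
  extension of a positive semidefinite \<open>M(r - 1)\<close>.
\<close>

definition flat_completion ::
    "nat \<Rightarrow> (nat ^ 'n::finite \<Rightarrow> real) \<Rightarrow> nat ^ 'n \<Rightarrow> real" where
  "flat_completion r \<delta> =
     (THE \<omega>. moment_extension r \<delta> r \<omega> \<and> (\<forall>s\<ge>r. flat_extension s \<omega> \<omega>))"


section \<open>Localizing matrices\<close>

text \<open>The functional \<open>\<Lambda>\<^sub>\<omega>\<close>, used both for real and for complex polynomials.\<close>

definition riesz :: "(nat ^ 'n::finite \<Rightarrow> real) \<Rightarrow> ('n, 'a::real_vector) mpoly \<Rightarrow> 'a" where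
  "riesz \<omega> p = (\<Sum>i\<in>Poly_Mapping.keys p. \<omega> i *\<^sub>R Poly_Mapping.lookup p i)"

definition is_localizing_matrix ::
    "nat \<Rightarrow> ('n::finite, real) mpoly \<Rightarrow> (nat ^ 'n \<Rightarrow> real) \<Rightarrow> (nat ^ 'n \<Rightarrow> nat ^ 'n \<Rightarrow> real) \<Rightarrow> bool"
  where
  "is_localizing_matrix l q \<omega> A \<longleftrightarrow>
     (\<forall>i j. i \<notin> idx_le l \<or> j \<notin> idx_le l \<longrightarrow> A i j = 0) \<and>
     (\<forall>f g :: ('n, complex) mpoly. mpoly_deg f \<le> l \<longrightarrow> mpoly_deg g \<le> l \<longrightarrow>
        (\<Sum>i\<in>idx_le l. (\<Sum>j\<in>idx_le l. of_real (A i j) * Poly_Mapping.lookup f j)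
            * cnj (Poly_Mapping.lookup g i))
        = riesz \<omega> (Poly_Mapping.map of_real q * f * Poly_Mapping.map cnj g))"

text \<open>
  The number \<open>k\<close> with \<open>deg q = 2k\<close> or \<open>deg q = 2k - 1\<close> is \<open>(deg q + 1) div 2\<close>; accordingly
  \<open>localizing_matrix s q \<omega>\<close> is \<open>M\<^sub>q(s)\<close>, indexed by \<^term>\<open>idx_le l\<close> where \<open>s = l + k\<close>.
\<close>

definition localizing_matrix ::
    "nat \<Rightarrow> ('n::finite, real) mpoly \<Rightarrow> (nat ^ 'n \<Rightarrow> real) \<Rightarrow> nat ^ 'n \<Rightarrow> nat ^ 'n \<Rightarrow> real" where
  "localizing_matrix s q \<omega> =
     (THE A. is_localizing_matrix (s - (mpoly_deg q + 1) div 2) q \<omega> A)"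


subsection \<open>The localizing matrix is well defined\<close>

lemma finite_idx_le [simp]: "finite (idx_le d :: (nat ^ 'n::finite) set)"
proof -
  have "idx_le d \<subseteq> vec_lambda ` (UNIV \<rightarrow>\<^sub>E {..d} :: ('n \<Rightarrow> nat) set)"
  proof
    fix i :: "nat ^ 'n" assume "i \<in> idx_le d"
    then have *: "(\<Sum>k\<in>UNIV. i $ k) \<le> d" by (simp add: idx_le_def idx_deg_def)
    have "i $ k \<le> d" for k
      using member_le_sum[of k UNIV "\<lambda>k. i $ k"] * by simp
    then have "($) i \<in> UNIV \<rightarrow>\<^sub>E {..d}" by auto
    then have "vec_lambda (($) i) \<in> vec_lambda ` (UNIV \<rightarrow>\<^sub>E {..d})" by (rule imageI)
    then show "i \<in> vec_lambda ` (UNIV \<rightarrow>\<^sub>E {..d})" by simp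
  qed
  then show ?thesis by (rule finite_subset) (intro finite_imageI finite_PiE, auto)
qed

lemma riesz_superset:
  assumes "finite F" "Poly_Mapping.keys p \<subseteq> F"
  shows "riesz \<omega> p = (\<Sum>i\<in>F. \<omega> i *\<^sub>R Poly_Mapping.lookup p i)"
  unfolding riesz_def using assms by (intro sum.mono_neutral_left) (auto simp: in_keys_iff)

lemma riesz_zero [simp]: "riesz \<omega> 0 = 0"
  by (simp add: riesz_def)

lemma riesz_add: "riesz \<omega> (p + q) = riesz \<omega> p + riesz \<omega> q"
proof -
  let ?F = "Poly_Mapping.keys p \<union> Poly_Mapping.keys q"
  have "riesz \<omega> (p + q) = (\<Sum>i\<in>?F. \<omega> i *\<^sub>R Poly_Mapping.lookup (p + q) i)"
    using Poly_Mapping.keys_add[of p q] by (intro riesz_superset) auto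
  moreover have "riesz \<omega> p = (\<Sum>i\<in>?F. \<omega> i *\<^sub>R Poly_Mapping.lookup p i)"
    by (intro riesz_superset) auto
  moreover have "riesz \<omega> q = (\<Sum>i\<in>?F. \<omega> i *\<^sub>R Poly_Mapping.lookup q i)"
    by (intro riesz_superset) auto
  ultimately show ?thesis
    by (simp add: lookup_add scaleR_add_right sum.distrib)
qed

lemma riesz_sum: "riesz \<omega> (\<Sum>x\<in>X. p x) = (\<Sum>x\<in>X. riesz \<omega> (p x))"
  by (induction X rule: infinite_finite_induct) (auto simp: riesz_add)

lemma riesz_single [simp]: "riesz \<omega> (Poly_Mapping.single i c) = \<omega> i *\<^sub>R c"
  by (simp add: riesz_def)

lemma poly_mapping_decompose:
  assumes "finite F" "Poly_Mapping.keys p \<subseteq> F"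
  shows "p = (\<Sum>i\<in>F. Poly_Mapping.single i (Poly_Mapping.lookup p i))"
proof (rule poly_mapping_eqI)
  fix k
  show "Poly_Mapping.lookup p k =
      Poly_Mapping.lookup (\<Sum>i\<in>F. Poly_Mapping.single i (Poly_Mapping.lookup p i)) k"
    using assms by (auto simp: lookup_sum lookup_single when_def sum.delta in_keys_iff)
qed

lemma keys_subset_idx_le:
  assumes "mpoly_deg p \<le> l"
  shows "Poly_Mapping.keys p \<subseteq> idx_le l"
proof
  fix i assume "i \<in> Poly_Mapping.keys p"
  then have "idx_deg i \<le> mpoly_deg p" unfolding mpoly_deg_def by (intro Max_ge) auto
  then show "i \<in> idx_le l" using assms by (simp add: idx_le_def)
qed

lemma mpoly_deg_single: "i \<in> idx_le l \<Longrightarrow> mpoly_deg (Poly_Mapping.single i c) \<le> l"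
  by (auto simp: mpoly_deg_def idx_le_def)

lemma riesz_mult_single:
  fixes q :: "('n::finite, real) mpoly" and c :: complex
  shows "riesz \<omega> (Poly_Mapping.map of_real q * Poly_Mapping.single a c)
    = of_real (riesz \<omega> (q * Poly_Mapping.single a 1)) * c"
proof -
  let ?F = "Poly_Mapping.keys q"
  have q: "q = (\<Sum>b\<in>?F. Poly_Mapping.single b (Poly_Mapping.lookup q b))"
    by (rule poly_mapping_decompose) auto
  have "Poly_Mapping.keys (Poly_Mapping.map of_real q :: ('n, complex) mpoly) \<subseteq> ?F"
    by (auto simp: in_keys_iff map.rep_eq when_def)
  then have qc: "Poly_Mapping.map of_real q =
      (\<Sum>b\<in>?F. Poly_Mapping.single b (complex_of_real (Poly_Mapping.lookup q b)))"
    by (subst poly_mapping_decompose[of ?F]) (auto simp: map.rep_eq in_keys_iff when_def)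
  have "riesz \<omega> (q * Poly_Mapping.single a 1)
      = (\<Sum>b\<in>?F. \<omega> (b + a) * Poly_Mapping.lookup q b)"
    by (subst q) (simp add: sum_distrib_right mult_single riesz_sum)
  moreover have "riesz \<omega> (Poly_Mapping.map of_real q * Poly_Mapping.single a c)
      = (\<Sum>b\<in>?F. \<omega> (b + a) *\<^sub>R (of_real (Poly_Mapping.lookup q b) * c))"
    by (simp add: qc sum_distrib_right mult_single riesz_sum)
  ultimately show ?thesis
    by (simp add: sum_distrib_right scaleR_conv_of_real mult.assoc)
qed

lemma is_localizing_matrix_iff:
  "is_localizing_matrix l q \<omega> A \<longleftrightarrow>
     A = (\<lambda>i j. if i \<in> idx_le l \<and> j \<in> idx_le l
                then riesz \<omega> (q * Poly_Mapping.single (i + j) 1) else 0)"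
  (is "_ \<longleftrightarrow> A = ?B")
proof
  assume A: "is_localizing_matrix l q \<omega> A"
  show "A = ?B"
  proof (intro ext)
    fix i j
    show "A i j = ?B i j"
    proof (cases "i \<in> idx_le l \<and> j \<in> idx_le l")
      case True
      let ?f = "Poly_Mapping.single j (1::complex)" and ?g = "Poly_Mapping.single i (1::complex)"
      have "(\<Sum>i'\<in>idx_le l. (\<Sum>j'\<in>idx_le l. of_real (A i' j') * Poly_Mapping.lookup ?f j')
            * cnj (Poly_Mapping.lookup ?g i'))
        = riesz \<omega> (Poly_Mapping.map of_real q * ?f * Poly_Mapping.map cnj ?g)"
        using A True mpoly_deg_single unfolding is_localizing_matrix_def by blast
      moreover have "(\<Sum>i'\<in>idx_le l. (\<Sum>j'\<in>idx_le l. of_real (A i' j') * Poly_Mapping.lookup ?f j')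
            * cnj (Poly_Mapping.lookup ?g i')) = of_real (A i j)"
        using True by (simp add: lookup_single when_def if_distrib sum.delta cong: if_cong)
      moreover have "riesz \<omega> (Poly_Mapping.map of_real q * ?f * Poly_Mapping.map cnj ?g)
          = of_real (riesz \<omega> (q * Poly_Mapping.single (i + j) 1))"
        by (simp add: map_single mult.assoc mult_single riesz_mult_single add.commute)
      ultimately show ?thesis using True by (simp only: of_real_eq_iff) simp
    next
      case False
      then show ?thesis using A unfolding is_localizing_matrix_def by auto
    qed
  qed
next
  assume A: "A = ?B"
  have "(\<Sum>i\<in>idx_le l. (\<Sum>j\<in>idx_le l. of_real (A i j) * Poly_Mapping.lookup f j)
            * cnj (Poly_Mapping.lookup g i))
        = riesz \<omega> (Poly_Mapping.map of_real q * f * Poly_Mapping.map cnj g)"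
    if deg: "mpoly_deg f \<le> l" "mpoly_deg g \<le> l" for f g :: "('a, complex) mpoly"
  proof -
    have f: "f = (\<Sum>j\<in>idx_le l. Poly_Mapping.single j (Poly_Mapping.lookup f j))"
      using keys_subset_idx_le[OF deg(1)] by (intro poly_mapping_decompose) auto
    have "Poly_Mapping.keys (Poly_Mapping.map cnj g) \<subseteq> idx_le l"
      using keys_subset_idx_le[OF deg(2)]
      by (auto simp: in_keys_iff map.rep_eq when_def subset_iff split: if_splits)
    then have g: "Poly_Mapping.map cnj g =
        (\<Sum>i\<in>idx_le l. Poly_Mapping.single i (cnj (Poly_Mapping.lookup g i)))"
      by (subst poly_mapping_decompose[of "idx_le l"])
         (auto simp: map.rep_eq when_def intro!: sum.cong)
    have "riesz \<omega> (Poly_Mapping.map of_real q * f * Poly_Mapping.map cnj g)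
      = riesz \<omega> (\<Sum>i\<in>idx_le l. \<Sum>j\<in>idx_le l. Poly_Mapping.map of_real q *
          Poly_Mapping.single (i + j) (Poly_Mapping.lookup f j * cnj (Poly_Mapping.lookup g i)))"
      by (subst f, subst g)
         (simp add: sum_distrib_left sum_distrib_right mult.assoc mult_single add.commute)
    also have "\<dots> = (\<Sum>i\<in>idx_le l. \<Sum>j\<in>idx_le l. of_real (A i j) *
          (Poly_Mapping.lookup f j * cnj (Poly_Mapping.lookup g i)))"
      by (simp add: riesz_sum riesz_mult_single A)
    finally show ?thesis by (simp add: sum_distrib_right mult.assoc)
  qed
  then show "is_localizing_matrix l q \<omega> A"
    unfolding is_localizing_matrix_def using A by auto
qed

lemma localizing_matrix_eq:
  "localizing_matrix s q \<omega> i j =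
     (let l = s - (mpoly_deg q + 1) div 2 in
      if i \<in> idx_le l \<and> j \<in> idx_le l
      then riesz \<omega> (q * Poly_Mapping.single (i + j) 1) else 0)"
  unfolding localizing_matrix_def is_localizing_matrix_iff the_eq_trivial Let_def by simp

end

theory Submission
  imports Defs "HOL-Computational_Algebra.Fundamental_Theorem_Algebra"
begin

text \<open>
  Let \<open>M(l + 1)(\<delta>)\<close> be a flat extension of \<open>M(l) \<ge> 0\<close>. Flatness says that modulo the kernel of
  \<open>M(l + 1)\<close> every polynomial of degree at most \<open>l + 1\<close> has a representative of degree at most \<open>l\<close>, so
  multiplication by each variable acts on the column space of \<open>M(l)\<close>. With the inner product
  \<open>\<Lambda>(fg)\<close> these operators are self-adjoint and commute. A common orthonormal eigenbasis yields the
  atoms (joint eigenvalues) and the weights (squared coordinates of the polynomial 1); the eigenvectors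
  themselves are interpolating polynomials of degree at most \<open>l\<close> at the atoms, so testing a localizing
  matrix on their coefficients gives the value of \<open>q\<close> at an atom. The moments of this measure form the
  flat completion, which is unique because the relations expressing monomials of degree \<open>l + 1\<close>
  through lower ones persist in every further flat extension and so determine all moments recursively.

  Conversely, Caratheodory's argument reduces a finitely atomic measure to at most
  \<open>D = (2n + N choose N)\<close> of its atoms. Polynomials of degree \<open>2D\<close> interpolate at these, hence all
  moment matrices from \<open>M(2D)\<close> on have rank equal to the number of atoms.
\<close>

section \<open>Linear algebra\<close>

text \<open>In a general real vector space \<open>dim\<close> is 0 for sets of infinite dimension,
  so monotonicity needs the finite spanning set \<open>F\<close>, from which a basis of
  \<open>T\<close> is seen to be finite.\<close>

lemma dim_span_mono:
  fixes S T :: "'v::real_vector set"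
  assumes "finite F" "T \<subseteq> span F" "S \<subseteq> span T"
  shows "dim S \<le> dim T"
proof -
  obtain C where C: "C \<subseteq> T" "independent C" "T \<subseteq> span C" "card C = dim T"
    by (rule basis_exists)
  have "finite C"
    using independent_span_bound[OF assms(1) C(2)] C(1) assms(2) by auto
  moreover have "S \<subseteq> span C"
    using assms(3) C(3) span_minimal[OF C(3) subspace_span] by auto
  ultimately show ?thesis
    using dim_le_card C(4) by metis
qed

text \<open>If a maximal independent subset of \<open>S\<close> missed some vector of
  \<open>T\<close>, adding it would give an independent set larger than \<open>dim T\<close>. This
  converts rank equalities into equalities of column spaces.\<close>

lemma span_eq_of_dim_le:
  fixes S T :: "'v::real_vector set"
  assumes "finite F" "T \<subseteq> span F" "S \<subseteq> span T" "dim T \<le> dim S"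
  shows "span S = span T"
proof -
  obtain B where B: "B \<subseteq> S" "independent B" "S \<subseteq> span B" "card B = dim S"
    by (rule basis_exists)
  have TF: "span T \<subseteq> span F"
    by (rule span_minimal[OF assms(2) subspace_span])
  have finB: "finite B"
    using independent_span_bound[OF assms(1) B(2)] B(1) assms(3) TF by auto
  have "T \<subseteq> span B"
  proof
    fix t assume t: "t \<in> T"
    show "t \<in> span B"
    proof (rule ccontr)
      assume nt: "t \<notin> span B"
      then have ind: "independent (insert t B)"
        by (simp add: B(2) independent_insertI)
      have "card (insert t B) = Suc (card B)"
        using nt finB span_base by (metis card_insert_disjoint)
      moreover have "card (insert t B) = dim (insert t B)"
        using dim_eq_card_independent[OF ind] by simp
      moreover have "insert t B \<subseteq> span T"
        using t B(1) assms(3) span_base by blast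
      ultimately show False
        using dim_span_mono[OF assms(1,2), of "insert t B"] assms(4) B(4) by simp
    qed
  qed
  then have "span T \<subseteq> span S"
    using span_mono[OF B(1)] by (meson span_minimal subspace_span subset_trans)
  moreover have "span S \<subseteq> span T"
    by (rule span_minimal[OF assms(3) subspace_span])
  ultimately show ?thesis by auto
qed

text \<open>The relation is indexed by \<open>I\<close>, not by the image of \<open>f\<close>, so
  that repeated values count: \<open>f i = f j\<close> with \<open>i \<noteq> j\<close> is itself a
  relation.\<close>

lemma nontrivial_relation:
  fixes f :: "'i \<Rightarrow> 'v::real_vector"
  assumes "finite F" "finite I" "card F < card I" "f ` I \<subseteq> span F"
  obtains c where "\<exists>i\<in>I. c i \<noteq> 0" "(\<Sum>i\<in>I. c i *\<^sub>R f i) = 0"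
proof (cases "inj_on f I")
  case True
  then have "card (f ` I) > card F"
    using assms(3) by (simp add: card_image)
  then have "dependent (f ` I)"
    using independent_span_bound[OF assms(1) _ assms(4)] by auto
  then obtain u where u: "\<exists>v\<in>f ` I. u v \<noteq> 0" "(\<Sum>v\<in>f ` I. u v *\<^sub>R v) = 0"
    using dependent_finite[of "f ` I"] assms(2) by auto
  show thesis
    using u that[of "u \<circ> f"] by (simp add: sum.reindex[OF True])
next
  case False
  then obtain i j where ij: "i \<in> I" "j \<in> I" "i \<noteq> j" "f i = f j"
    by (auto simp: inj_on_def)
  define c where "c = (\<lambda>l. if l = i then 1 else if l = j then -1 else 0::real)"
  have "(\<Sum>l\<in>I. c l *\<^sub>R f l) = (\<Sum>l\<in>{i, j}. c l *\<^sub>R f l)"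
    by (intro sum.mono_neutral_right) (use assms(2) ij in \<open>auto simp: c_def\<close>)
  also have "\<dots> = 0"
    using ij by (simp add: c_def)
  finally show thesis
    using that[of c] ij(1) by (force simp: c_def)
qed

section \<open>Commuting self-adjoint operators\<close>

definition op_poly :: "('v::real_vector \<Rightarrow> 'v) \<Rightarrow> real poly \<Rightarrow> 'v \<Rightarrow> 'v" where
  "op_poly T p v = fold_coeffs (\<lambda>a w. a *\<^sub>R v + T w) p 0"

context
  fixes T :: "'v::real_vector \<Rightarrow> 'v"
  assumes lin: "linear T"
begin

lemma op_poly_0 [simp]: "op_poly T 0 v = 0"
  by (simp add: op_poly_def)

lemma op_poly_pCons [simp]: "op_poly T (pCons a p) v = a *\<^sub>R v + T (op_poly T p v)"
  by (cases "p = 0 \<and> a = 0") (auto simp: op_poly_def linear_0[OF lin])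

lemma op_poly_add: "op_poly T (p + r) v = op_poly T p v + op_poly T r v"
proof (induction p arbitrary: r)
  case (pCons a p)
  then show ?case
    by (cases r) (simp add: linear_add[OF lin] scaleR_add_left)
qed simp

lemma op_poly_smult: "op_poly T (smult a p) v = a *\<^sub>R op_poly T p v"
  by (induction p) (simp_all add: linear_cmul[OF lin] scaleR_add_right)

lemma op_poly_mult: "op_poly T (p * r) v = op_poly T p (op_poly T r v)"
  by (induction p) (simp_all add: op_poly_add op_poly_smult)

lemma op_poly_sum: "op_poly T (\<Sum>i\<in>A. p i) v = (\<Sum>i\<in>A. op_poly T (p i) v)"
  by (induction A rule: infinite_finite_induct) (simp_all add: op_poly_add)

lemma op_poly_monom: "op_poly T (monom a i) v = a *\<^sub>R (T ^^ i) v"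
  by (induction i) (simp_all add: monom_0 monom_Suc linear_cmul[OF lin] linear_0[OF lin])

lemma op_poly_mem:
  assumes "subspace M" "T ` M \<subseteq> M" "v \<in> M"
  shows "op_poly T p v \<in> M"
  using assms by (induction p) (auto intro!: subspace_add subspace_scale subspace_0)

text \<open>The \<open>card F + 1\<close> vectors \<open>(T ^^ i) v\<close> with
  \<open>i \<le> card F\<close> lie in \<open>span F\<close>; a linear relation between them
  supplies the coefficients of \<open>p\<close>.\<close>

lemma exists_annihilator:
  assumes "finite F" "M \<subseteq> span F" "T ` M \<subseteq> M" "v \<in> M"
  obtains p where "p \<noteq> 0" "op_poly T p v = 0"
proof -
  have "(T ^^ i) v \<in> M" for i
    using assms(3,4) by (induction i) auto
  then have "(\<lambda>i. (T ^^ i) v) ` {..card F} \<subseteq> span F"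
    using assms(2) by auto
  then obtain c where c: "\<exists>i\<in>{..card F}. c i \<noteq> 0" "(\<Sum>i\<le>card F. c i *\<^sub>R (T ^^ i) v) = 0"
    using nontrivial_relation[OF assms(1), of "{..card F}" "\<lambda>i. (T ^^ i) v"] by auto
  define p where "p = (\<Sum>i\<le>card F. monom (c i) i)"
  have "coeff p i = c i" if "i \<le> card F" for i
    using that by (simp add: p_def coeff_sum)
  then have "p \<noteq> 0"
    using c(1) by auto
  moreover have "op_poly T p v = 0"
    using c(2) by (simp add: p_def op_poly_sum op_poly_monom)
  ultimately show thesis by (rule that)
qed

end

section \<open>Nonreal roots of real polynomials\<close>

lemma map_poly_of_real_add:
  "map_poly (of_real :: real \<Rightarrow> complex) (p + r) = map_poly of_real p + map_poly of_real r"
  by (rule poly_eqI) (simp add: coeff_map_poly)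

lemma map_poly_of_real_mult:
  "map_poly (of_real :: real \<Rightarrow> complex) (p * r) = map_poly of_real p * map_poly of_real r"
  by (rule poly_eqI) (simp add: coeff_map_poly coeff_mult)

lemma poly_map_poly_of_real: "poly (map_poly complex_of_real p) (of_real x) = of_real (poly p x)"
  by (induction p) (simp_all add: map_poly_pCons)

text \<open>The quadratic is \<open>(X - z)(X - cnj z)\<close>. The remainder \<open>a + b X\<close>
  of \<open>p\<close> also vanishes at \<open>z\<close>; since \<open>a\<close> and \<open>b\<close>
  are real and \<open>Im z \<noteq> 0\<close>, both are zero.\<close>

lemma quadratic_dvd_of_complex_root:
  fixes p :: "real poly"
  assumes root: "poly (map_poly of_real p) z = 0" and im: "Im z \<noteq> 0"
  shows "[:(Re z)\<^sup>2 + (Im z)\<^sup>2, - 2 * Re z, 1:] dvd p"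
proof -
  let ?d = "[:(Re z)\<^sup>2 + (Im z)\<^sup>2, - 2 * Re z, 1:]"
  have d0: "poly (map_poly complex_of_real ?d) z = 0"
    by (auto simp: complex_eq_iff power2_eq_square map_poly_pCons algebra_simps)
  have "degree (p mod ?d) < 2"
    using degree_mod_less[of ?d p] by (cases "p mod ?d = 0") auto
  then have deg: "degree (p mod ?d) \<le> 1" by simp
  define a b where "a = coeff (p mod ?d) 0" and "b = coeff (p mod ?d) 1"
  have pm: "p mod ?d = [:a, b:]"
    by (intro poly_eqI) (use deg in \<open>auto simp: a_def b_def coeff_pCons coeff_eq_0 split: nat.split\<close>)
  have "p = (p div ?d) * ?d + [:a, b:]"
    using pm by (metis div_mult_mod_eq)
  then have "poly (map_poly complex_of_real p) z
      = poly (map_poly of_real ((p div ?d) * ?d)) z + poly (map_poly of_real [:a, b:]) z"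
    by (metis map_poly_of_real_add poly_add)
  then have "complex_of_real a + z * of_real b = 0"
    unfolding root map_poly_of_real_mult poly_mult d0 by (simp add: map_poly_pCons)
  then have "a = 0 \<and> b = 0"
    using im by (auto simp: complex_eq_iff)
  then show ?thesis
    using pm by (simp add: mod_eq_0_iff_dvd)
qed

text \<open>Let \<open>p\<close> be of least degree among the nonzero polynomials with
  \<open>p(T) v = 0\<close>. It has a complex root; dividing out the corresponding real factor
  leaves a cofactor \<open>r\<close> with \<open>r(T) v \<noteq> 0\<close> by minimality. A real
  root makes \<open>r(T) v\<close> an eigenvector, and positivity of \<open>B\<close> excludes
  nonreal roots.\<close>

lemma self_adjoint_eigenvector:
  fixes T :: "'v::real_vector \<Rightarrow> 'v" and B :: "'v \<Rightarrow> 'v \<Rightarrow> real"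
  assumes lin: "linear T" and bil: "bilinear B"
    and M: "subspace M" "finite F" "M \<subseteq> span F" "T ` M \<subseteq> M" "v \<in> M" "v \<noteq> 0"
    and adj: "\<And>x y. x \<in> M \<Longrightarrow> y \<in> M \<Longrightarrow> B (T x) y = B x (T y)"
    and pos: "\<And>x. x \<in> M \<Longrightarrow> x \<noteq> 0 \<Longrightarrow> B x x > 0"
  obtains a w where "w \<in> M" "w \<noteq> 0" "T w = a *\<^sub>R w"
proof -
  let ?P = "\<lambda>p. p \<noteq> 0 \<and> op_poly T p v = 0"
  obtain p0 where "?P p0"
    using exists_annihilator[OF lin M(2,3,4,5)] by blast
  then obtain p where p: "?P p" and pmin: "\<And>r. ?P r \<Longrightarrow> degree p \<le> degree r"
    using ex_has_least_nat[of ?P p0 degree] by blast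
  have "degree p \<noteq> 0"
  proof
    assume "degree p = 0"
    then obtain a where "p = [:a:]" by (rule degree_eq_zeroE)
    then show False
      using p M(6) by (simp add: op_poly_pCons[OF lin] op_poly_0[OF lin] linear_0[OF lin])
  qed
  then have "\<not> constant (poly (map_poly complex_of_real p))"
    by (simp add: constant_degree degree_map_poly)
  then obtain z where z: "poly (map_poly complex_of_real p) z = 0"
    using fundamental_theorem_of_algebra by blast
  have factor: "op_poly T d (op_poly T r v) = 0 \<and> op_poly T r v \<noteq> 0"
    if "p = d * r" "degree d > 0" for d r
  proof
    show "op_poly T d (op_poly T r v) = 0"
      using p that(1) by (simp add: op_poly_mult[OF lin])
    have "r \<noteq> 0" "d \<noteq> 0" using p that by auto
    then have "degree r < degree p"
      using that by (simp add: degree_mult_eq)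
    then show "op_poly T r v \<noteq> 0"
      using pmin[of r] \<open>r \<noteq> 0\<close> by auto
  qed
  have memr: "op_poly T r v \<in> M" for r
    by (rule op_poly_mem[OF lin M(1,4,5)])
  note ops = op_poly_pCons[OF lin] op_poly_0[OF lin] linear_0[OF lin]
  show thesis
  proof (cases "Im z = 0")
    case True
    then have "complex_of_real (poly p (Re z)) = 0"
      using z by (metis complex_is_Real_iff of_real_Re poly_map_poly_of_real)
    then have "[:- Re z, 1:] dvd p"
      by (simp add: poly_eq_0_iff_dvd)
    then obtain r where r: "p = [:- Re z, 1:] * r" by (rule dvdE)
    then show thesis
      using that[of "op_poly T r v" "Re z"] factor[OF r] memr[of r] by (auto simp: ops)
  next
    case False
    \<comment> \<open>A nonreal root would give \<open>S\<^sup>2 w = - (Im z)\<^sup>2 w\<close> for the self-adjoint \<open>S = T - Re z\<close>.\<close>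
    obtain r where r: "p = [:(Re z)\<^sup>2 + (Im z)\<^sup>2, - 2 * Re z, 1:] * r"
      using quadratic_dvd_of_complex_root[OF z False] by (rule dvdE)
    define w where "w = op_poly T r v"
    have w: "w \<in> M" "w \<noteq> 0"
      using factor[OF r] memr by (auto simp: w_def)
    define S where "S = (\<lambda>x. T x - Re z *\<^sub>R x)"
    have SM: "S x \<in> M" if "x \<in> M" for x
      using that M(1,4) by (auto simp: S_def intro!: subspace_diff subspace_scale)
    have adjS: "B (S x) y = B x (S y)" if "x \<in> M" "y \<in> M" for x y
      using adj[OF that] bil
      by (simp add: S_def bilinear_lsub bilinear_rsub bilinear_lmul bilinear_rmul)
    have "((Re z)\<^sup>2 + (Im z)\<^sup>2) *\<^sub>R w + (T (T w) - (2 * Re z) *\<^sub>R T w) = 0"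
      using factor[OF r] by (simp add: ops w_def[symmetric] linear_diff[OF lin] linear_cmul[OF lin])
    then have "T (T w) = (2 * Re z) *\<^sub>R T w - ((Re z)\<^sup>2 + (Im z)\<^sup>2) *\<^sub>R w"
      by (simp add: algebra_simps add_eq_0_iff2)
    moreover have "(2 * Re z) *\<^sub>R T w = Re z *\<^sub>R T w + Re z *\<^sub>R T w"
      by (simp add: scaleR_add_left[symmetric])
    ultimately have "S (S w) = - ((Im z)\<^sup>2) *\<^sub>R w"
      by (simp add: S_def linear_diff[OF lin] linear_cmul[OF lin] algebra_simps power2_eq_square)
    then have "B (S w) (S w) = - ((Im z)\<^sup>2 * B w w)"
      using adjS[OF w(1) SM[OF w(1)]] by (simp add: bilinear_rmul[OF bil] bilinear_rneg[OF bil])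
    moreover have "B w w > 0" using pos w by auto
    moreover have "B (S w) (S w) \<ge> 0"
      using pos[OF SM[OF w(1)]] bilinear_rzero[OF bil] by (cases "S w = 0") auto
    ultimately show thesis
      using False by (smt (verit) mult_pos_pos zero_less_power2)
  qed
qed

lemma common_eigenvector:
  fixes T :: "'n \<Rightarrow> 'v::real_vector \<Rightarrow> 'v" and B :: "'v \<Rightarrow> 'v \<Rightarrow> real"
  assumes lin: "\<And>k. linear (T k)" and bil: "bilinear B"
    and H: "subspace H" "finite F" "H \<subseteq> span F" "\<And>k. T k ` H \<subseteq> H" "H \<noteq> {0}"
    and adj: "\<And>k x y. x \<in> H \<Longrightarrow> y \<in> H \<Longrightarrow> B (T k x) y = B x (T k y)"
    and comm: "\<And>k j x. x \<in> H \<Longrightarrow> T k (T j x) = T j (T k x)"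
    and pos: "\<And>x. x \<in> H \<Longrightarrow> x \<noteq> 0 \<Longrightarrow> B x x > 0"
  obtains a w where "w \<in> H" "w \<noteq> 0" "\<And>k. T k w = a k *\<^sub>R w"
proof -
  \<comment> \<open>On a nonzero invariant subspace of minimal dimension every \<open>T k\<close> is a scalar.\<close>
  let ?P = "\<lambda>M. subspace M \<and> M \<subseteq> H \<and> M \<noteq> {0} \<and> (\<forall>k. T k ` M \<subseteq> M)"
  have "?P H" using H by auto
  then obtain M where M: "?P M" and Mmin: "\<And>N. ?P N \<Longrightarrow> dim M \<le> dim N"
    using ex_has_least_nat[of ?P H dim] by blast
  obtain v where v: "v \<in> M" "v \<noteq> 0"
    using M subspace_0 by blast
  have MF: "M \<subseteq> span F" using M H(3) by auto
  have "\<exists>a. \<forall>x\<in>M. T k x = a *\<^sub>R x" for k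
  proof -
    obtain a w where w: "w \<in> M" "w \<noteq> 0" "T k w = a *\<^sub>R w"
      by (rule self_adjoint_eigenvector[OF lin[of k] bil _ H(2) MF _ v])
        (use M adj pos in \<open>auto simp: subset_iff\<close>)
    \<comment> \<open>Since the operators commute, this eigenspace of \<open>T k\<close> is
      invariant under every \<open>T j\<close>; minimality of \<open>dim M\<close> then forces it to
      be all of \<open>M\<close>.\<close>
    define N where "N = {x \<in> M. T k x = a *\<^sub>R x}"
    have sub: "subspace N"
      using M by (auto simp: N_def subspace_def linear_0[OF lin] linear_add[OF lin] linear_cmul[OF lin]
          scaleR_add_right)
    have "T j ` N \<subseteq> N" for j
    proof
      fix y assume "y \<in> T j ` N"
      then obtain x where x: "x \<in> M" "T k x = a *\<^sub>R x" "y = T j x" by (auto simp: N_def)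
      have "T k y = T j (T k x)"
        using comm x(1,3) M by auto
      then show "y \<in> N"
        using x M by (auto simp: N_def linear_cmul[OF lin])
    qed
    then have "?P N"
      using sub w M by (auto simp: N_def)
    then have "span N = span M"
      using Mmin by (intro span_eq_of_dim_le[OF H(2) MF]) (auto simp: N_def span_base)
    then have "N = M"
      using sub M by (metis span_eq_iff)
    then show ?thesis by (auto simp: N_def)
  qed
  then obtain a where "\<And>k x. x \<in> M \<Longrightarrow> T k x = a k *\<^sub>R x" by metis
  then show thesis
    using that[of v a] v M by auto
qed

text \<open>Induction on the dimension: normalise one common eigenvector \<open>e\<close> and
  continue in its orthogonal complement \<open>H'\<close> in \<open>H\<close>, which is invariant
  because the operators are self-adjoint.\<close>

lemma common_orthonormal_eigenbasis:
  fixes T :: "'n \<Rightarrow> 'v::real_vector \<Rightarrow> 'v" and B :: "'v \<Rightarrow> 'v \<Rightarrow> real"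
  assumes lin: "\<And>k. linear (T k)" and bil: "bilinear B" and sym: "\<And>x y. B x y = B y x"
    and F: "finite F"
    and H: "subspace H" "H \<subseteq> span F" "\<And>k. T k ` H \<subseteq> H"
    and adj: "\<And>k x y. x \<in> H \<Longrightarrow> y \<in> H \<Longrightarrow> B (T k x) y = B x (T k y)"
    and comm: "\<And>k j x. x \<in> H \<Longrightarrow> T k (T j x) = T j (T k x)"
    and pos: "\<And>x. x \<in> H \<Longrightarrow> x \<noteq> 0 \<Longrightarrow> B x x > 0"
  shows "\<exists>U ev. finite U \<and> U \<subseteq> H \<and> H \<subseteq> span U \<and>
           (\<forall>u\<in>U. \<forall>w\<in>U. B u w = (if u = w then 1 else 0)) \<and> (\<forall>u\<in>U. \<forall>k. T k u = ev u k *\<^sub>R u)"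
  using H adj comm pos
proof (induction "dim H" arbitrary: H rule: less_induct)
  case less
  show ?case
  proof (cases "H = {0}")
    case True
    then show ?thesis by (intro exI[of _ "{}"]) auto
  next
    case False
    have "\<exists>a w. w \<in> H \<and> w \<noteq> 0 \<and> (\<forall>k. T k w = a k *\<^sub>R w)"
      by (rule common_eigenvector[where T = T, OF lin bil less.prems(1) F less.prems(2,3) False less.prems(4,5,6)])
        auto
    then obtain a w where w: "w \<in> H" "w \<noteq> 0" "\<And>k. T k w = a k *\<^sub>R w"
      by auto
    have Bw: "B w w > 0" using less.prems(6) w by auto
    define e where "e = (1 / sqrt (B w w)) *\<^sub>R w"
    have e: "e \<in> H" "B e e = 1" "\<And>k. T k e = a k *\<^sub>R e"
      using w Bw less.prems(1)
      by (auto simp: e_def subspace_scale bilinear_lmul[OF bil] bilinear_rmul[OF bil]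
          linear_cmul[OF lin] field_simps)
    define H' where "H' = {x \<in> H. B e x = 0}"
    have sub: "subspace H'"
      using less.prems(1)
      by (auto simp: H'_def subspace_def bilinear_radd[OF bil] bilinear_rmul[OF bil] bilinear_rzero[OF bil])
    have "e \<notin> H'" using e by (simp add: H'_def)
    have lt: "dim H' < dim H"
    proof (rule ccontr)
      assume "\<not> dim H' < dim H"
      then have "span H' = span H"
        by (intro span_eq_of_dim_le[OF F less.prems(2)]) (auto simp: H'_def span_base)
      then show False
        using \<open>e \<notin> H'\<close> e(1) sub less.prems(1) by (metis span_eq_iff)
    qed
    have inv: "T k ` H' \<subseteq> H'" for k
    proof
      fix y assume "y \<in> T k ` H'"
      then obtain x where x: "x \<in> H" "B e x = 0" "y = T k x" by (auto simp: H'_def)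
      have "B e y = B (T k e) x"
        using less.prems(4) e(1) x by simp
      then show "y \<in> H'"
        using x less.prems(3) by (auto simp: H'_def e(3) bilinear_lmul[OF bil])
    qed
    have sH: "H' \<subseteq> H" by (auto simp: H'_def)
    have "\<exists>U ev. finite U \<and> U \<subseteq> H' \<and> H' \<subseteq> span U \<and>
        (\<forall>u\<in>U. \<forall>w\<in>U. B u w = (if u = w then 1 else 0)) \<and> (\<forall>u\<in>U. \<forall>k. T k u = ev u k *\<^sub>R u)"
    proof (rule less.hyps[OF lt sub _ inv])
      show "H' \<subseteq> span F"
        using sH less.prems(2) by (rule subset_trans)
      show "B (T k x) y = B x (T k y)" if "x \<in> H'" "y \<in> H'" for k x y
        using less.prems(4) that sH by blast
      show "T k (T j x) = T j (T k x)" if "x \<in> H'" for k j x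
        using less.prems(5) that sH by blast
      show "B x x > 0" if "x \<in> H'" "x \<noteq> 0" for x
        using less.prems(6) that sH by blast
    qed
    then obtain U ev where U: "finite U" "U \<subseteq> H'" "H' \<subseteq> span U"
      "\<forall>u\<in>U. \<forall>w\<in>U. B u w = (if u = w then 1 else 0)" "\<forall>u\<in>U. \<forall>k. T k u = ev u k *\<^sub>R u"
      by blast
    have "e \<notin> U" using U(2) \<open>e \<notin> H'\<close> by auto
    have "H \<subseteq> span (insert e U)"
    proof
      fix x assume x: "x \<in> H"
      have "x - B e x *\<^sub>R e \<in> H'"
        using x e less.prems(1)
        by (auto simp: H'_def subspace_diff subspace_scale bilinear_rsub[OF bil] bilinear_rmul[OF bil])
      then show "x \<in> span (insert e U)"
        using U(3) span_breakdown_eq by blast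
    qed
    moreover have "\<forall>u\<in>insert e U. \<forall>w\<in>insert e U. B u w = (if u = w then 1 else 0)"
      using U(2,4) e(2) \<open>e \<notin> U\<close> sym by (auto simp: H'_def subset_iff)
    moreover have "\<forall>u\<in>insert e U. \<forall>k. T k u = (ev(e := a)) u k *\<^sub>R u"
      using U(5) e(3) \<open>e \<notin> U\<close> by auto
    ultimately show ?thesis
      using U(1,2) e(1) sH by (intro exI[of _ "insert e U"] exI[of _ "ev(e := a)"]) auto
  qed
qed

section \<open>Multi-indices and polynomials of bounded degree\<close>

lemma idx_deg_0 [simp]: "idx_deg 0 = 0"
  by (simp add: idx_deg_def)

lemma idx_deg_add [simp]: "idx_deg (i + j) = idx_deg i + idx_deg j"
  by (simp add: idx_deg_def sum.distrib)

lemma idx_deg_axis [simp]: "idx_deg (axis k c) = c"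
  by (simp add: idx_deg_def axis_def)

lemma idx_deg_eq_0_iff: "idx_deg i = 0 \<longleftrightarrow> i = 0"
  by (simp add: idx_deg_def vec_eq_iff)

lemma idx_le_add: "i \<in> idx_le a \<Longrightarrow> j \<in> idx_le b \<Longrightarrow> i + j \<in> idx_le (a + b)"
  by (simp add: idx_le_def)

lemma idx_le_mono: "a \<le> b \<Longrightarrow> idx_le a \<subseteq> idx_le b"
  by (auto simp: idx_le_def)

lemma zero_mem_idx_le [simp]: "0 \<in> idx_le d"
  by (simp add: idx_le_def)

lemma idx_deg_SucE:
  fixes i :: "nat ^ 'n::finite"
  assumes "idx_deg i = Suc d"
  obtains i' k where "i = i' + axis k 1" "idx_deg i' = d"
proof -
  have "i \<noteq> 0" using assms by auto
  then obtain k where k: "i $ k > 0"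
    by (auto simp: vec_eq_iff)
  then have "i = (i - axis k 1) + axis k 1"
    by (auto simp: vec_eq_iff axis_def)
  moreover from this have "idx_deg (i - axis k 1) = d"
    using assms by (metis add_diff_cancel_right' diff_Suc_1 idx_deg_add idx_deg_axis)
  ultimately show thesis by (rule that)
qed

lemma idx_deg_splitE:
  fixes i :: "nat ^ 'n::finite"
  assumes "idx_deg i = a + b"
  obtains j k where "i = j + k" "idx_deg j = a" "idx_deg k = b"
  using assms
proof (induction b arbitrary: i thesis)
  case 0
  then show ?case by (metis add_0_right idx_deg_0)
next
  case (Suc b)
  obtain i' m where i': "i = i' + axis m 1" "idx_deg i' = a + b"
    using Suc.prems(2) by (auto elim: idx_deg_SucE)
  then obtain j k where "i' = j + k" "idx_deg j = a" "idx_deg k = b"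
    using Suc.IH by blast
  then show ?case
    using Suc.prems(1)[of j "k + axis m 1"] i' by (simp add: add.assoc)
qed

lemma idx_pow_0 [simp]: "idx_pow t 0 = 1"
  by (simp add: idx_pow_def)

lemma idx_pow_add: "idx_pow t (i + j) = idx_pow t i * idx_pow t j"
  by (simp add: idx_pow_def power_add prod.distrib)

lemma idx_pow_axis [simp]: "idx_pow t (axis k 1) = t $ k"
proof -
  have "idx_pow t (axis k 1) = (\<Prod>m\<in>UNIV. if m = k then t $ k else 1)"
    unfolding idx_pow_def by (intro prod.cong) (auto simp: axis_def)
  then show ?thesis by simp
qed

section \<open>Polynomials as a real vector space\<close>

lemma lookup_scaleR [simp]:
  "Poly_Mapping.lookup (r *\<^sub>R p) i = r *\<^sub>R Poly_Mapping.lookup p i"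
proof -
  have "finite {i. r *\<^sub>R Poly_Mapping.lookup p i \<noteq> 0}"
    by (rule finite_subset[OF _ finite_lookup[of p]]) auto
  then show ?thesis by (simp add: scaleR_poly_mapping_def)
qed

lemma scaleR_eq_single_mult:
  fixes p :: "('n::finite, real) mpoly"
  shows "r *\<^sub>R p = Poly_Mapping.single 0 r * p"
proof -
  have "r *\<^sub>R p = Poly_Mapping.map ((*) r) p"
    by (rule poly_mapping_eqI) (simp add: map.rep_eq when_def)
  then show ?thesis by (simp add: mult_map_scale_conv_mult)
qed

lemma scaleR_single: "r *\<^sub>R Poly_Mapping.single i c = Poly_Mapping.single i (r * c :: real)"
  by (rule poly_mapping_eqI) (simp add: lookup_single when_def)

lemma mpoly_mult_scaleR_left [simp]: "(r *\<^sub>R p) * g = r *\<^sub>R (p * g)"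
  for p g :: "('n::finite, real) mpoly"
  by (simp add: scaleR_eq_single_mult mult.assoc)

lemma mpoly_mult_scaleR_right [simp]: "p * (r *\<^sub>R g) = r *\<^sub>R (p * g)"
  for p g :: "('n::finite, real) mpoly"
  by (simp add: scaleR_eq_single_mult mult.left_commute)

lemma riesz_scaleR [simp]: "riesz \<omega> (r *\<^sub>R p) = r * riesz \<omega> p" for p :: "('n::finite, real) mpoly"
proof -
  have "riesz \<omega> (r *\<^sub>R p) = (\<Sum>i\<in>Poly_Mapping.keys p. \<omega> i *\<^sub>R Poly_Mapping.lookup (r *\<^sub>R p) i)"
    by (rule riesz_superset) (auto simp: in_keys_iff)
  then show ?thesis by (simp add: riesz_def sum_distrib_left mult.left_commute)
qed

lemma linear_riesz: "linear (riesz \<omega> :: ('n::finite, real) mpoly \<Rightarrow> real)"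
  by (rule linearI) (simp_all add: riesz_add)

lemma riesz_diff: "riesz \<omega> (p - g) = riesz \<omega> p - riesz \<omega> g" for p g :: "('n::finite, real) mpoly"
  by (rule linear_diff[OF linear_riesz])

text \<open>The degree bound is put on \<open>keys\<close> instead of on the maximum in
  \<open>mpoly_deg\<close>, which makes closure under linear operations a matter of set
  inclusion.\<close>

definition polys_le :: "nat \<Rightarrow> ('n::finite, real) mpoly set" where
  "polys_le d = {p. Poly_Mapping.keys p \<subseteq> idx_le d}"

lemma polys_le_eq_span:
  "(polys_le d :: ('n::finite, real) mpoly set) = span ((\<lambda>i. Poly_Mapping.single i 1) ` idx_le d)"
proof (rule antisym)
  show "(polys_le d :: ('n, real) mpoly set) \<subseteq> span ((\<lambda>i. Poly_Mapping.single i 1) ` idx_le d)"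
  proof
    fix p :: "('n, real) mpoly" assume p: "p \<in> polys_le d"
    have "p = (\<Sum>i\<in>idx_le d. Poly_Mapping.lookup p i *\<^sub>R Poly_Mapping.single i 1)"
      using poly_mapping_decompose[of "idx_le d" p] p by (simp add: polys_le_def scaleR_single)
    also have "\<dots> \<in> span ((\<lambda>i. Poly_Mapping.single i 1) ` idx_le d)"
      by (intro span_sum span_scale span_base imageI)
    finally show "p \<in> span ((\<lambda>i. Poly_Mapping.single i 1) ` idx_le d)" .
  qed
  have "subspace (polys_le d :: ('n, real) mpoly set)"
    by (auto simp: subspace_def polys_le_def in_keys_iff lookup_add subset_iff) (metis add_0)
  then show "span ((\<lambda>i. Poly_Mapping.single i 1) ` idx_le d) \<subseteq> (polys_le d :: ('n, real) mpoly set)"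
    by (intro span_minimal) (auto simp: polys_le_def)
qed

lemma subspace_polys_le: "subspace (polys_le d)"
  by (simp add: polys_le_eq_span)

lemmas polys_le_add = subspace_add[OF subspace_polys_le]
  and polys_le_diff = subspace_diff[OF subspace_polys_le]
  and polys_le_scale = subspace_scale[OF subspace_polys_le]
  and polys_le_sum = subspace_sum[OF subspace_polys_le]

lemma polys_le_mono: "a \<le> b \<Longrightarrow> polys_le a \<subseteq> polys_le b"
  using idx_le_mono[of a b] by (auto simp: polys_le_def)

lemma single_mem_polys_le: "i \<in> idx_le d \<Longrightarrow> Poly_Mapping.single i c \<in> polys_le d"
  by (simp add: polys_le_def)

lemma mult_mem_polys_le: "p \<in> polys_le a \<Longrightarrow> g \<in> polys_le b \<Longrightarrow> p * g \<in> polys_le (a + b)"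
  using keys_mult[of p g] idx_le_add unfolding polys_le_def by blast

lemma polys_le_expand:
  assumes "p \<in> polys_le d"
  shows "p = (\<Sum>i\<in>idx_le d. Poly_Mapping.lookup p i *\<^sub>R Poly_Mapping.single i 1)"
  using poly_mapping_decompose[of "idx_le d" p] assms by (simp add: polys_le_def scaleR_single)

lemma riesz_mult_expand:
  assumes "g \<in> polys_le d"
  shows "riesz \<omega> (p * g) =
    (\<Sum>i\<in>idx_le d. Poly_Mapping.lookup g i * riesz \<omega> (p * Poly_Mapping.single i 1))"
proof -
  have "p * g = (\<Sum>i\<in>idx_le d. Poly_Mapping.lookup g i *\<^sub>R (p * Poly_Mapping.single i 1))"
    using arg_cong[OF polys_le_expand[OF assms], of "(*) p"] by (simp add: sum_distrib_left)
  then show ?thesis by (simp add: riesz_sum)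
qed

text \<open>The moments of the unit point mass at \<open>t\<close> are \<open>idx_pow t\<close>, so
  evaluation is a Riesz functional and inherits its linearity.\<close>

lemma mpoly_eval_eq_riesz: "mpoly_eval p t = riesz (idx_pow t) p"
  by (simp add: mpoly_eval_def riesz_def mult.commute)

lemma linear_mpoly_eval: "linear (\<lambda>p. mpoly_eval p t)"
  by (simp add: mpoly_eval_eq_riesz linear_riesz)

lemma mpoly_eval_mult: "mpoly_eval (p * g) t = mpoly_eval p t * mpoly_eval g t"
proof -
  have p: "p = (\<Sum>i\<in>Poly_Mapping.keys p. Poly_Mapping.single i (Poly_Mapping.lookup p i))" for p :: "('a, real) mpoly"
    by (rule poly_mapping_decompose) auto
  have "riesz (idx_pow t) (p * g)
      = (\<Sum>i\<in>Poly_Mapping.keys p. \<Sum>j\<in>Poly_Mapping.keys g.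
          idx_pow t (i + j) * (Poly_Mapping.lookup p i * Poly_Mapping.lookup g j))"
    by (subst p[of p], subst p[of g])
       (simp add: sum_distrib_left sum_distrib_right mult_single riesz_sum, rule sum.swap)
  also have "\<dots> = riesz (idx_pow t) p * riesz (idx_pow t) g"
    unfolding riesz_def sum_product by (intro sum.cong refl) (simp add: idx_pow_add)
  finally show ?thesis by (simp add: mpoly_eval_eq_riesz)
qed

lemma mpoly_eval_single [simp]: "mpoly_eval (Poly_Mapping.single i c) t = idx_pow t i * c"
  by (simp add: mpoly_eval_eq_riesz)

lemma mpoly_eval_expand:
  assumes "p \<in> polys_le d"
  shows "mpoly_eval p x = (\<Sum>i\<in>idx_le d. Poly_Mapping.lookup p i * idx_pow x i)"
  using riesz_superset[of "idx_le d" p "idx_pow x"] assms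
  by (simp add: mpoly_eval_eq_riesz polys_le_def mult.commute)

lemma riesz_atomic:
  assumes "\<And>i. i \<in> idx_le d \<Longrightarrow> \<omega> i = (\<Sum>x\<in>S. \<rho> x * idx_pow x i)" "p \<in> polys_le d"
  shows "riesz \<omega> p = (\<Sum>x\<in>S. \<rho> x * mpoly_eval p x)"
proof -
  have "riesz \<omega> p = (\<Sum>i\<in>Poly_Mapping.keys p. \<Sum>x\<in>S. \<rho> x * (Poly_Mapping.lookup p i * idx_pow x i))"
    unfolding riesz_def using assms by (intro sum.cong) (auto simp: polys_le_def sum_distrib_right sum_distrib_left mult_ac)
  then show ?thesis
    by (simp add: mpoly_eval_def sum_distrib_left sum.swap[of _ S])
qed

section \<open>Column spaces of moment matrices\<close>

text \<open>For \<open>deg f \<le> s\<close> this is the product of \<open>M(s)(\<omega>)\<close> with the coefficient vector of \<open>f\<close>.\<close>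

definition moment_vec :: "nat \<Rightarrow> (nat ^ 'n::finite \<Rightarrow> real) \<Rightarrow> ('n, real) mpoly \<Rightarrow> (nat ^ 'n \<Rightarrow>\<^sub>0 real)" where
  "moment_vec s \<omega> f = (\<Sum>i\<in>idx_le s. Poly_Mapping.single i (riesz \<omega> (f * Poly_Mapping.single i 1)))"

lemma lookup_moment_vec:
  "Poly_Mapping.lookup (moment_vec s \<omega> f) i =
     (if i \<in> idx_le s then riesz \<omega> (f * Poly_Mapping.single i 1) else 0)"
  by (auto simp: moment_vec_def lookup_sum lookup_single when_def)

lemma linear_moment_vec: "linear (moment_vec s \<omega>)"
  by (rule linearI)
     (rule poly_mapping_eqI, simp add: lookup_moment_vec lookup_add distrib_right riesz_add)+

text \<open>Column relations are used below as identities of the functional. The degrees of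
  \<open>f\<close> and \<open>g\<close> are not bounded by \<open>s\<close>, so polynomials of
  degree \<open>s + 1\<close> can be compared through their rows of degree at most
  \<open>s\<close>.\<close>

lemma moment_vec_eq_iff:
  "moment_vec s \<omega> f = moment_vec s \<omega> g \<longleftrightarrow> (\<forall>v\<in>polys_le s. riesz \<omega> (f * v) = riesz \<omega> (g * v))"
proof
  assume eq: "moment_vec s \<omega> f = moment_vec s \<omega> g"
  have "riesz \<omega> (f * Poly_Mapping.single i 1) = riesz \<omega> (g * Poly_Mapping.single i 1)" if "i \<in> idx_le s" for i
    using arg_cong[OF eq, of "\<lambda>p. Poly_Mapping.lookup p i"] that by (simp add: lookup_moment_vec)
  then show "\<forall>v\<in>polys_le s. riesz \<omega> (f * v) = riesz \<omega> (g * v)"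
    by (simp add: riesz_mult_expand)
next
  assume "\<forall>v\<in>polys_le s. riesz \<omega> (f * v) = riesz \<omega> (g * v)"
  then show "moment_vec s \<omega> f = moment_vec s \<omega> g"
    by (intro poly_mapping_eqI) (simp add: lookup_moment_vec single_mem_polys_le)
qed

lemma moment_vec_image_subset_span:
  "moment_vec s \<omega> ` A \<subseteq> span ((\<lambda>i. Poly_Mapping.single i 1) ` idx_le s)"
  by (auto simp flip: polys_le_eq_span simp: polys_le_def in_keys_iff lookup_moment_vec split: if_splits)

text \<open>The second sequence \<open>\<omega>\<close> allows the rank of
  \<open>M(l)(\<gamma>)\<close> to be computed with an extension of \<open>\<gamma>\<close>. The
  image of \<open>polys_le s\<close> is the column space because monomials are sent to
  columns.\<close>

lemma moment_rank_eq_dim: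
  assumes "\<And>i. i \<in> idx_le (2 * s) \<Longrightarrow> \<gamma> i = \<omega> i"
  shows "moment_rank s \<gamma> = dim (moment_vec s \<omega> ` polys_le s)"
proof -
  have "mat_col (idx_le s) (moment_matrix s \<gamma>) j = moment_vec s \<omega> (Poly_Mapping.single j 1)"
    if "j \<in> idx_le s" for j
    unfolding mat_col_def moment_vec_def
  proof (intro sum.cong refl)
    fix i :: "nat ^ 'a" assume "i \<in> idx_le s"
    then show "Poly_Mapping.single i (moment_matrix s \<gamma> i j) =
        Poly_Mapping.single i (riesz \<omega> (Poly_Mapping.single j 1 * Poly_Mapping.single i 1))"
      using assms[of "i + j"] that idx_le_add[of i s j s]
      by (simp add: moment_matrix_def mult_single add.commute mult_2)
  qed
  then have "mat_col (idx_le s) (moment_matrix s \<gamma>) ` idx_le s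
      = moment_vec s \<omega> ` (\<lambda>j. Poly_Mapping.single j 1) ` idx_le s"
    by (simp add: image_image)
  then show ?thesis
    unfolding mat_rank_def polys_le_eq_span
    by (simp flip: linear_span_image[OF linear_moment_vec])
qed

lemma dim_linear_image_le:
  fixes f :: "'a::real_vector \<Rightarrow> 'b::real_vector"
  assumes "linear f" "finite F" "V \<subseteq> span F"
  shows "dim (f ` V) \<le> dim V"
proof -
  obtain B where B: "B \<subseteq> V" "independent B" "V \<subseteq> span B" "card B = dim V"
    by (rule basis_exists)
  have "finite B"
    using independent_span_bound[OF assms(2) B(2)] B(1) assms(3) by auto
  moreover have "f ` V \<subseteq> span (f ` B)"
    using B(3) linear_span_image[OF assms(1)] by blast
  ultimately show ?thesis
    using dim_le_card[of "f ` V" "f ` B"] card_image_le[of B f] B(4) by simp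
qed

text \<open>Deleting the rows of degree \<open>s + 1\<close> (the map \<open>R\<close>) sends the
  columns of \<open>M(s + 1)\<close> of degree at most \<open>s\<close> to those of
  \<open>M(s)\<close>. Hence these columns span a space of dimension at least the rank of
  \<open>M(s)\<close>, which by flatness is the rank of \<open>M(s + 1)\<close>, so they span its
  whole column space.\<close>

lemma flat_extension_reduce:
  assumes flat: "flat_extension s \<gamma> \<delta>" and f: "f \<in> polys_le (s + 1)"
  obtains p where "p \<in> polys_le s" "\<And>g. g \<in> polys_le (s + 1) \<Longrightarrow> riesz \<delta> (f * g) = riesz \<delta> (p * g)"
proof -
  let ?\<phi> = "moment_vec (s + 1) \<delta>"
  let ?F = "(\<lambda>i. Poly_Mapping.single i (1::real)) ` idx_le (s + 1)"
  define R where "R p = (\<Sum>i\<in>idx_le s. Poly_Mapping.single i (Poly_Mapping.lookup p i))"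
    for p :: "nat ^ 'a \<Rightarrow>\<^sub>0 real"
  have lookup_R: "Poly_Mapping.lookup (R p) i = (if i \<in> idx_le s then Poly_Mapping.lookup p i else 0)" for p i
    by (auto simp: R_def lookup_sum lookup_single when_def)
  have linR: "linear R"
    by (rule linearI) (rule poly_mapping_eqI, simp add: lookup_R lookup_add)+
  have "R (?\<phi> f) = moment_vec s \<delta> f" for f
    using idx_le_mono[of s "s + 1"]
    by (intro poly_mapping_eqI) (auto simp: lookup_R lookup_moment_vec)
  then have "moment_vec s \<delta> ` polys_le s = R ` ?\<phi> ` polys_le s"
    by (simp add: image_image)
  then have "dim (moment_vec s \<delta> ` polys_le s) \<le> dim (?\<phi> ` polys_le s)"
    using dim_linear_image_le[OF linR _ moment_vec_image_subset_span] by simp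
  moreover have "dim (?\<phi> ` polys_le (s + 1)) = dim (moment_vec s \<delta> ` polys_le s)"
    using flat moment_rank_eq_dim[of "s + 1" \<delta> \<delta>] moment_rank_eq_dim[of s \<gamma> \<delta>]
    by (simp add: flat_extension_def moment_extension_def)
  ultimately have "span (?\<phi> ` polys_le s) = span (?\<phi> ` polys_le (s + 1))"
    using polys_le_mono[of s "s + 1"]
    by (intro span_eq_of_dim_le[of ?F] moment_vec_image_subset_span) (auto intro: span_base)
  moreover have "span (?\<phi> ` polys_le d) = ?\<phi> ` polys_le d" for d
    by (simp add: linear_subspace_image[OF linear_moment_vec subspace_polys_le] span_eq_iff)
  ultimately have "?\<phi> f \<in> ?\<phi> ` polys_le s"
    using f by blast
  then show thesis
    using that moment_vec_eq_iff by blast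
qed

text \<open>Every column is a combination of the vectors \<open>v x\<close> of monomial values at
  the atoms. The interpolating polynomial of \<open>x\<close> is mapped to
  \<open>\<rho> x *\<^sub>R v x\<close>, so the \<open>v x\<close> lie in the column space, and they
  are independent.\<close>

lemma moment_rank_atomic:
  fixes S :: "(real ^ 'n::finite) set"
  assumes S: "finite S" "\<And>x. x \<in> S \<Longrightarrow> \<rho> x > 0"
    and mom: "\<And>i. i \<in> idx_le (2 * s) \<Longrightarrow> \<omega> i = (\<Sum>x\<in>S. \<rho> x * idx_pow x i)"
    and interp: "\<And>x. x \<in> S \<Longrightarrow> \<exists>f\<in>polys_le s. \<forall>y\<in>S. mpoly_eval f y = (if y = x then 1 else 0)"
  shows "moment_rank s \<omega> = card S"
proof -
  define v where "v x = (\<Sum>i\<in>idx_le s. Poly_Mapping.single i (idx_pow x i))" for x :: "real ^ 'n"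
  have lookup_v: "Poly_Mapping.lookup (v x) i = (if i \<in> idx_le s then idx_pow x i else 0)" for x i
    by (auto simp: v_def lookup_sum lookup_single when_def)
  obtain e where e: "\<And>x. x \<in> S \<Longrightarrow> e x \<in> polys_le s"
    "\<And>x y. x \<in> S \<Longrightarrow> y \<in> S \<Longrightarrow> mpoly_eval (e x) y = (if y = x then 1 else 0)"
    using interp by metis
  have vec: "moment_vec s \<omega> f = (\<Sum>x\<in>S. (\<rho> x * mpoly_eval f x) *\<^sub>R v x)" if "f \<in> polys_le s" for f
  proof (rule poly_mapping_eqI)
    fix i
    have "riesz \<omega> (f * Poly_Mapping.single i 1) = (\<Sum>x\<in>S. \<rho> x * mpoly_eval f x * idx_pow x i)"
      if "i \<in> idx_le s"
      using riesz_atomic[OF mom mult_mem_polys_le[OF \<open>f \<in> _\<close> single_mem_polys_le[OF that]], folded mult_2]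
      by (simp add: mpoly_eval_mult mult.assoc)
    then show "Poly_Mapping.lookup (moment_vec s \<omega> f) i
        = Poly_Mapping.lookup (\<Sum>x\<in>S. (\<rho> x * mpoly_eval f x) *\<^sub>R v x) i"
      by (simp add: lookup_moment_vec lookup_sum lookup_v)
  qed
  have "moment_vec s \<omega> (e x) = \<rho> x *\<^sub>R v x" if "x \<in> S" for x
  proof -
    have "moment_vec s \<omega> (e x) = (\<Sum>y\<in>S. if y = x then \<rho> x *\<^sub>R v x else 0)"
      unfolding vec[OF e(1)[OF that]] using that by (intro sum.cong) (auto simp: e(2))
    then show ?thesis using S(1) that by simp
  qed
  then have "v x \<in> span (moment_vec s \<omega> ` polys_le s)" if "x \<in> S" for x
    using S(2) e(1) that span_scale[OF span_base, of "\<rho> x *\<^sub>R v x" "moment_vec s \<omega> ` polys_le s" "inverse (\<rho> x)"]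
    by (metis imageI less_irrefl real_vector.scale_scale scaleR_one left_inverse)
  then have "span (v ` S) \<subseteq> span (moment_vec s \<omega> ` polys_le s)"
    by (intro span_minimal) auto
  moreover have "span (moment_vec s \<omega> ` polys_le s) \<subseteq> span (v ` S)"
    by (intro span_minimal image_subsetI subspace_span)
       (simp add: vec, intro span_sum span_scale span_base imageI)
  ultimately have "dim (moment_vec s \<omega> ` polys_le s) = dim (v ` S)"
    by (intro span_eq_dim) auto
  \<comment> \<open>Pairing with the coefficients of \<open>e x\<close> evaluates \<open>e x\<close>
    at the atom, so the functionals \<open>D x\<close> are dual to the vectors
    \<open>v y\<close>.\<close>
  define D where "D x p = (\<Sum>i\<in>idx_le s. Poly_Mapping.lookup (e x) i * Poly_Mapping.lookup p i)"
    for x p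
  have linD: "linear (D x)" for x
    by (rule linearI) (simp_all add: D_def lookup_add distrib_left sum.distrib sum_distrib_left mult_ac)
  have Dv: "D x (v y) = (if y = x then 1 else 0)" if "x \<in> S" "y \<in> S" for x y
  proof -
    have "mpoly_eval (e x) y = D x (v y)"
      unfolding mpoly_eval_def D_def using e(1)[OF that(1)]
      by (intro sum.mono_neutral_cong_left) (auto simp: polys_le_def in_keys_iff lookup_v)
    then show ?thesis using e(2)[OF that] by simp
  qed
  have inj: "inj_on v S"
    by (rule inj_onI) (metis Dv zero_neq_one)
  have "independent (v ` S)"
  proof
    assume "dependent (v ` S)"
    then obtain u x where u: "x \<in> S" "u (v x) \<noteq> 0" "(\<Sum>w\<in>v ` S. u w *\<^sub>R w) = 0"
      using S(1) by (auto simp: dependent_finite)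
    have "0 = D x (\<Sum>y\<in>S. u (v y) *\<^sub>R v y)"
      using u(3) by (simp add: sum.reindex[OF inj] linear_0[OF linD])
    also have "\<dots> = (\<Sum>y\<in>S. if y = x then u (v x) else 0)"
      unfolding linear_sum[OF linD] using u(1)
      by (intro sum.cong) (auto simp: linear_cmul[OF linD] Dv)
    finally show False using S(1) u by simp
  qed
  then have "dim (v ` S) = card S"
    by (simp add: dim_eq_card_independent card_image[OF inj])
  then show ?thesis
    using \<open>dim (moment_vec s \<omega> ` polys_le s) = dim (v ` S)\<close> moment_rank_eq_dim[of s \<omega> \<omega>] by simp
qed

section \<open>Uniqueness of the successive flat extensions\<close>

text \<open>A kernel relation \<open>f\<close> of \<open>M(l + 1)(\<delta>)\<close> persists against
  test polynomials of every degree. By induction on their degree: flatness at level \<open>s\<close>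
  replaces \<open>g\<close> of degree \<open>s + 1\<close> by some \<open>p\<close> of degree at
  most \<open>s\<close> without changing the pairing with \<open>f\<close>.\<close>

lemma flat_extension_recursion:
  assumes flat: "flat_extension l \<gamma> \<delta>"
    and ext: "moment_extension (l + 1) \<delta> (l + 1) \<omega>"
    and flats: "\<And>s. s \<ge> l + 1 \<Longrightarrow> flat_extension s \<omega> \<omega>"
    and f: "f \<in> polys_le (l + 1)"
    and f0: "\<And>g. g \<in> polys_le (l + 1) \<Longrightarrow> riesz \<delta> (f * g) = 0"
  shows "riesz \<omega> (f * g) = 0"
proof -
  have "\<forall>g\<in>polys_le s. riesz \<omega> (f * g) = 0" if "l + 1 \<le> s" for s
    using that
  proof (induction s rule: dec_induct)
    case base
    show ?case
    proof
      fix g :: "('a, real) mpoly" assume g: "g \<in> polys_le (l + 1)"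
      have "f * g \<in> polys_le (2 * (l + 1))"
        using mult_mem_polys_le[OF f g] by (simp only: mult_2)
      then have "riesz \<omega> (f * g) = riesz \<delta> (f * g)"
        unfolding riesz_def using ext
        by (intro sum.cong refl) (auto simp: polys_le_def moment_extension_def)
      then show "riesz \<omega> (f * g) = 0" using f0[OF g] by simp
    qed
  next
    case (step s)
    show ?case
    proof
      fix g :: "('a, real) mpoly" assume g: "g \<in> polys_le (Suc s)"
      obtain p where p: "p \<in> polys_le s"
        "\<And>h. h \<in> polys_le (s + 1) \<Longrightarrow> riesz \<omega> (g * h) = riesz \<omega> (p * h)"
        using flat_extension_reduce[OF flats[OF step.hyps(1)], of g] g by auto
      have "f \<in> polys_le (s + 1)"
        using f polys_le_mono[of "l + 1" "s + 1"] step.hyps by auto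
      then show "riesz \<omega> (f * g) = 0"
        using p(2)[of f] p(1) step.IH by (simp add: mult.commute[of g] mult.commute[of p])
    qed
  qed
  moreover obtain s where "l + 1 \<le> s" "g \<in> polys_le s"
  proof
    show "g \<in> polys_le (max (l + 1) (mpoly_deg g))"
      unfolding polys_le_def using keys_subset_idx_le[of g "max (l + 1) (mpoly_deg g)"] by auto
  qed auto
  ultimately show ?thesis by blast
qed

text \<open>For large \<open>i = a + b\<close> with \<open>|a| = l + 1\<close>, reduce the monomial
  of \<open>a\<close> to some \<open>p\<close> of degree at most \<open>l\<close>, using
  \<open>\<delta>\<close> alone. Multiplying this relation by the monomial of \<open>b\<close>
  expresses the moment at \<open>i\<close> through moments of smaller degree, by the same formula
  for both sequences.\<close>

lemma flat_completion_unique: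
  assumes flat: "flat_extension l \<gamma> \<delta>"
    and \<omega>: "moment_extension (l + 1) \<delta> (l + 1) \<omega>" "\<And>s. s \<ge> l + 1 \<Longrightarrow> flat_extension s \<omega> \<omega>"
    and \<omega>': "moment_extension (l + 1) \<delta> (l + 1) \<omega>'" "\<And>s. s \<ge> l + 1 \<Longrightarrow> flat_extension s \<omega>' \<omega>'"
  shows "\<omega>' = \<omega>"
proof
  fix i
  show "\<omega>' i = \<omega> i"
  proof (induction "idx_deg i" arbitrary: i rule: less_induct)
    case less
    show ?case
    proof (cases "idx_deg i \<le> 2 * (l + 1)")
      case True
      then show ?thesis
        using \<omega>(1) \<omega>'(1) by (simp add: moment_extension_def idx_le_def)
    next
      case False
      then obtain a b where ab: "i = a + b" "idx_deg a = l + 1" "idx_deg b = idx_deg i - (l + 1)"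
        using idx_deg_splitE[of i "l + 1" "idx_deg i - (l + 1)"] by auto
      define f :: "('a, real) mpoly" where "f = Poly_Mapping.single a 1"
      have f: "f \<in> polys_le (l + 1)"
        using ab(2) by (simp add: f_def single_mem_polys_le idx_le_def)
      obtain p where p: "p \<in> polys_le l"
        "\<And>g. g \<in> polys_le (l + 1) \<Longrightarrow> riesz \<delta> (f * g) = riesz \<delta> (p * g)"
        using flat_extension_reduce[OF flat f] by blast
      have fp: "f - p \<in> polys_le (l + 1)"
        using f p(1) polys_le_mono[of l "l + 1"] by (auto intro: polys_le_diff)
      have fp0: "riesz \<delta> ((f - p) * g) = 0" if "g \<in> polys_le (l + 1)" for g
        using p(2)[OF that] by (simp add: left_diff_distrib riesz_diff)
      let ?b = "Poly_Mapping.single b (1::real)"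
      have val: "\<nu> i = riesz \<nu> (p * ?b)"
        if "moment_extension (l + 1) \<delta> (l + 1) \<nu>" "\<And>s. s \<ge> l + 1 \<Longrightarrow> flat_extension s \<nu> \<nu>" for \<nu>
        using flat_extension_recursion[OF flat that fp fp0, of ?b]
        by (simp add: left_diff_distrib riesz_diff f_def mult_single ab(1))
      have "p * ?b \<in> polys_le (l + idx_deg b)"
        using p(1) by (intro mult_mem_polys_le single_mem_polys_le) (auto simp: idx_le_def)
      then have "idx_deg c < idx_deg i" if "c \<in> Poly_Mapping.keys (p * ?b)" for c
        using that ab(3) False by (auto simp: polys_le_def idx_le_def)
      then have "\<omega>' c = \<omega> c" if "c \<in> Poly_Mapping.keys (p * ?b)" for c
        using that by (intro less.hyps) auto
      then have "riesz \<omega>' (p * ?b) = riesz \<omega> (p * ?b)"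
        by (simp add: riesz_def)
      then show ?thesis
        using val[OF \<omega>] val[OF \<omega>'] by simp
    qed
  qed
qed

text \<open>Eliminates the \<open>THE\<close> once a candidate is known; in both directions of the
  theorem the candidate is the moment sequence of a finitely atomic measure.\<close>

lemma flat_completion_eq:
  assumes flat: "flat_extension l \<gamma> \<delta>"
    and \<omega>: "moment_extension (l + 1) \<delta> (l + 1) \<omega>" "\<And>s. s \<ge> l + 1 \<Longrightarrow> flat_extension s \<omega> \<omega>"
  shows "flat_completion (l + 1) \<delta> = \<omega>"
  unfolding flat_completion_def
proof (rule the_equality)
  show "moment_extension (l + 1) \<delta> (l + 1) \<omega> \<and> (\<forall>s\<ge>l + 1. flat_extension s \<omega> \<omega>)"
    using \<omega> by blast
next
  fix \<omega>' assume "moment_extension (l + 1) \<delta> (l + 1) \<omega>' \<and> (\<forall>s\<ge>l + 1. flat_extension s \<omega>' \<omega>')"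
  then show "\<omega>' = \<omega>"
    by (intro flat_completion_unique[OF flat \<omega>]) auto
qed

section \<open>Flat extensions are moment matrices of finitely atomic measures\<close>

text \<open>The two hypotheses are positivity and flatness read through the functional. The
  interpolating polynomials in the conclusion later fix the ranks of all further moment matrices and
  isolate single atoms in localizing matrices.\<close>

lemma flat_extension_atomic:
  fixes \<delta> :: "nat ^ 'n::finite \<Rightarrow> real"
  assumes psd: "\<And>f. f \<in> polys_le l \<Longrightarrow> riesz \<delta> (f * f) \<ge> 0"
    and flat: "\<And>f. f \<in> polys_le (l + 1) \<Longrightarrow>
      \<exists>p\<in>polys_le l. \<forall>g\<in>polys_le (l + 1). riesz \<delta> (f * g) = riesz \<delta> (p * g)"
  obtains S \<rho> where "finite S" "\<And>x. x \<in> S \<Longrightarrow> \<rho> x > 0"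
    "\<And>i. i \<in> idx_le (2 * (l + 1)) \<Longrightarrow> \<delta> i = (\<Sum>x\<in>S. \<rho> x * idx_pow x i)"
    "\<And>x. x \<in> S \<Longrightarrow> \<exists>f\<in>polys_le l. \<forall>y\<in>S. mpoly_eval f y = (if y = x then 1 else 0)"
proof -
  let ?L = "riesz \<delta> :: ('n, real) mpoly \<Rightarrow> real"
  let ?V = "polys_le l :: ('n, real) mpoly set" and ?W = "polys_le (l + 1) :: ('n, real) mpoly set"
  let ?\<phi> = "moment_vec l \<delta>"
  define t where "t k = Poly_Mapping.single (axis k (1::nat)) (1::real)" for k :: 'n
  have VW: "f \<in> ?W" if "f \<in> ?V" for f
    using that polys_le_mono[of l "l + 1"] by auto
  have tW: "t k * f \<in> ?W" if "f \<in> ?V" for k f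
    using mult_mem_polys_le[OF single_mem_polys_le[of "axis k 1" 1] that]
    by (simp add: t_def idx_le_def add.commute)
  \<comment> \<open>The equality case of Cauchy-Schwarz for a semidefinite form: an isotropic
    \<open>f\<close> is orthogonal to everything.\<close>
  have radical: "?L (f * g) = 0" if f: "f \<in> ?V" "?L (f * f) = 0" and g: "g \<in> ?V" for f g
  proof -
    have "?L (g * g) + 2 * r * ?L (f * g) \<ge> 0" for r
    proof -
      have "g + r *\<^sub>R f \<in> ?V"
        using f g by (intro polys_le_add polys_le_scale)
      then show ?thesis
        using psd[of "g + r *\<^sub>R f"] f(2)
        by (simp add: distrib_left distrib_right riesz_add mult.commute[of g f])
    qed
    \<comment> \<open>If \<open>?L (f * g)\<close> is nonzero, this \<open>r\<close> gives the
      expression the value \<open>-1\<close>.\<close>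
    from this[of "- (?L (g * g) + 1) / (2 * ?L (f * g))"] show ?thesis
      by (cases "?L (f * g) = 0") (auto simp: field_simps)
  qed
  \<comment> \<open>\<open>?\<phi> f = 0\<close> only tests against degree at most \<open>l\<close>;
    flatness, applied to \<open>g\<close>, extends the test to degree \<open>l + 1\<close>.\<close>
  have kernel: "?L (f * g) = 0" if f: "f \<in> ?W" "?\<phi> f = 0" and g: "g \<in> ?W" for f g
  proof -
    obtain p where p: "p \<in> ?V" "\<forall>h\<in>?W. ?L (g * h) = ?L (p * h)"
      using flat[OF g] by blast
    have "?\<phi> f = ?\<phi> 0"
      using f(2) by (simp add: linear_0[OF linear_moment_vec])
    then have "?L (f * p) = 0"
      using p(1) by (simp add: moment_vec_eq_iff)
    then show ?thesis
      using p(2) f(1) by (simp add: mult.commute[of f])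
  qed
  \<comment> \<open>\<open>H\<close> models the polynomials modulo the kernel, and \<open>\<sigma>\<close> picks representatives of degree at most \<open>l\<close>.\<close>
  obtain \<sigma> where \<sigma>: "range \<sigma> \<subseteq> ?V" "linear \<sigma>" "\<And>h. h \<in> ?\<phi> ` ?V \<Longrightarrow> ?\<phi> (\<sigma> h) = h"
    using linear_exists_right_inverse_on[OF linear_moment_vec subspace_polys_le] by blast
  define H where "H = ?\<phi> ` ?V"
  have \<sigma>V: "\<sigma> h \<in> ?V" for h using \<sigma>(1) by auto
  have HW: "?\<phi> f \<in> H" if fW: "f \<in> ?W" for f
  proof -
    obtain p where p: "p \<in> ?V" "\<forall>h\<in>?W. ?L (f * h) = ?L (p * h)"
      using flat[OF fW] by blast
    then have "?\<phi> f = ?\<phi> p"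
      using VW by (simp add: moment_vec_eq_iff)
    then show ?thesis using p(1) by (simp add: H_def)
  qed
  \<comment> \<open>Against polynomials of degree at most \<open>l + 1\<close>, \<open>f\<close> may
    be exchanged for the chosen representative of its class, as their difference is in the
    kernel.\<close>
  have key: "?L (\<sigma> (?\<phi> f) * g) = ?L (f * g)" if "f \<in> ?W" "g \<in> ?W" for f g
  proof -
    have "?\<phi> (\<sigma> (?\<phi> f) - f) = 0"
      using \<sigma>(3) HW[OF that(1)] by (simp add: linear_diff[OF linear_moment_vec] H_def)
    then have "?L ((\<sigma> (?\<phi> f) - f) * g) = 0"
      using that VW[OF \<sigma>V] by (intro kernel polys_le_diff)
    then show ?thesis by (simp add: left_diff_distrib riesz_diff)
  qed
  have key': "?L (g * \<sigma> (?\<phi> f)) = ?L (g * f)" if "f \<in> ?W" "g \<in> ?W" for f g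
    using key[OF that] by (simp add: mult.commute)
  define B where "B h h' = ?L (\<sigma> h * \<sigma> h')" for h h'
  \<comment> \<open>Multiplication by a variable on classes: the product has degree at most
    \<open>l + 1\<close>, and \<open>HW\<close> puts its class back into \<open>H\<close>.\<close>
  define T where "T k h = ?\<phi> (t k * \<sigma> h)" for k h
  have linT: "linear (T k)" for k
    by (rule linearI)
       (simp_all add: T_def linear_add[OF \<sigma>(2)] linear_cmul[OF \<sigma>(2)] distrib_left
         linear_add[OF linear_moment_vec] linear_cmul[OF linear_moment_vec])
  have bil: "bilinear B"
    unfolding bilinear_def
    by (intro conjI allI linearI)
       (simp_all add: B_def linear_add[OF \<sigma>(2)] linear_cmul[OF \<sigma>(2)] distrib_left distrib_right riesz_add)
  have sym: "B x y = B y x" for x y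
    by (simp add: B_def mult.commute)
  have subH: "subspace H"
    by (simp add: H_def linear_subspace_image[OF linear_moment_vec subspace_polys_le])
  have TH: "T k ` H \<subseteq> H" for k
    using HW[OF tW[OF \<sigma>V]] by (auto simp: T_def)
  have pos: "B x x > 0" if "x \<in> H" "x \<noteq> 0" for x
  proof -
    have "B x x \<noteq> 0"
    proof
      assume "B x x = 0"
      then have "?\<phi> (\<sigma> x) = ?\<phi> 0"
        unfolding moment_vec_eq_iff using radical[OF \<sigma>V] by (simp add: B_def)
      then show False
        using that \<sigma>(3)[of x] by (simp add: H_def linear_0[OF linear_moment_vec])
    qed
    then show ?thesis using psd[OF \<sigma>V, of x] by (simp add: B_def)
  qed
  have eqI: "x = y" if "x \<in> H" "y \<in> H" "\<And>g. g \<in> H \<Longrightarrow> B x g = B y g" for x y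
  proof -
    have "x - y \<in> H" using that subH by (simp add: subspace_diff)
    then have "B (x - y) (x - y) = 0"
      using that(3) by (simp add: bilinear_lsub[OF bil])
    then show ?thesis using pos[OF \<open>x - y \<in> H\<close>] by auto
  qed
  have adj: "B (T k x) y = B x (T k y)" for k x y
  proof -
    have "B (T k x) y = ?L (t k * \<sigma> x * \<sigma> y)"
      unfolding B_def T_def by (rule key[OF tW[OF \<sigma>V] VW[OF \<sigma>V]])
    moreover have "B x (T k y) = ?L (\<sigma> x * (t k * \<sigma> y))"
      unfolding B_def T_def by (rule key'[OF tW[OF \<sigma>V] VW[OF \<sigma>V]])
    ultimately show ?thesis by (simp add: mult_ac)
  qed
  have comm: "T k (T j x) = T j (T k x)" if "x \<in> H" for k j x
  proof (rule eqI)
    \<comment> \<open>Two multiplications on one side would reach degree \<open>l + 2\<close>.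
      Moving one of them to the other side keeps both factors at degree at most
      \<open>l + 1\<close>, where \<open>key\<close> applies, and the result is symmetric in
      \<open>j\<close> and \<open>k\<close>.\<close>
    have BTT: "B (T k (T j x)) g = ?L ((t j * \<sigma> x) * (t k * \<sigma> g))" for k j g
    proof -
      have "B (T k (T j x)) g = ?L (\<sigma> (T j x) * \<sigma> (T k g))"
        using adj[of k "T j x" g] by (simp only: B_def)
      also have "\<dots> = ?L ((t j * \<sigma> x) * \<sigma> (T k g))"
        unfolding T_def by (rule key[OF tW[OF \<sigma>V] VW[OF \<sigma>V]])
      also have "\<dots> = ?L ((t j * \<sigma> x) * (t k * \<sigma> g))"
        unfolding T_def by (rule key'[OF tW[OF \<sigma>V] tW[OF \<sigma>V]])
      finally show ?thesis .
    qed
    show "B (T k (T j x)) g = B (T j (T k x)) g" if "g \<in> H" for g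
      unfolding BTT by (simp add: mult_ac)
  qed (use that TH in blast)+
  let ?F = "(\<lambda>i. Poly_Mapping.single i (1::real)) ` idx_le l"
  have "H \<subseteq> span ?F"
    unfolding H_def by (rule moment_vec_image_subset_span)
  then have "\<exists>U ev. finite U \<and> U \<subseteq> H \<and> H \<subseteq> span U \<and>
      (\<forall>u\<in>U. \<forall>w\<in>U. B u w = (if u = w then 1 else 0)) \<and> (\<forall>u\<in>U. \<forall>k. T k u = ev u k *\<^sub>R u)"
    by (rule common_orthonormal_eigenbasis[where T = T, OF linT bil sym _ subH _ TH adj comm pos, rotated])
      simp_all
  then obtain U ev where U: "finite U" "U \<subseteq> H" "H \<subseteq> span U"
    and UU: "\<forall>u\<in>U. \<forall>w\<in>U. B u w = (if u = w then 1 else 0)" "\<forall>u\<in>U. \<forall>k. T k u = ev u k *\<^sub>R u"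
    by (elim exE conjE)
  have orth: "B u w = (if u = w then 1 else 0)" if "u \<in> U" "w \<in> U" for u w
    using UU(1) that by blast
  have ev: "T k u = ev u k *\<^sub>R u" if "u \<in> U" for u k
    using UU(2) that by blast
  define pt where "pt u = (\<chi> k. ev u k)" for u
  define c where "c u = B (?\<phi> 1) u" for u
  have expand: "h = (\<Sum>u\<in>U. B h u *\<^sub>R u)" if hH: "h \<in> H" for h
  proof -
    obtain a where a: "h = (\<Sum>w\<in>U. a w *\<^sub>R w)"
      using hH U(1,3) by (auto simp: span_finite)
    have "B h u = a u" if "u \<in> U" for u
    proof -
      have "B h u = (\<Sum>w\<in>U. a w * B w u)"
        unfolding a using bil
        by (simp add: bilinear_def linear_sum[of "\<lambda>x. B x u"] linear_cmul[of "\<lambda>x. B x u"])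
      also have "\<dots> = (\<Sum>w\<in>U. if w = u then a u else 0)"
        using that by (intro sum.cong) (auto simp: orth)
      finally show ?thesis using that U(1) by simp
    qed
    then show ?thesis using a by simp
  qed
  \<comment> \<open>Each variable is moved onto the eigenvector \<open>u\<close> by self-adjointness
    and contributes its eigenvalue. Degree \<open>l + 1\<close> is reachable because the last
    multiplication acts on a monomial of degree at most \<open>l\<close>.\<close>
  have coord_monom: "B (?\<phi> (Poly_Mapping.single i 1)) u = idx_pow (pt u) i * c u"
    if "u \<in> U" "idx_deg i \<le> l + 1" for i u
    using that(2)
  proof (induction "idx_deg i" arbitrary: i)
    case 0
    then have "i = 0" by (simp add: idx_deg_eq_0_iff)
    then show ?case by (simp add: c_def)
  next
    case (Suc d)
    obtain i' k where i': "i = i' + axis k 1" "idx_deg i' = d"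
      using idx_deg_SucE[OF Suc.hyps(2)[symmetric]] .
    let ?f = "Poly_Mapping.single i' (1::real)"
    have f: "?f \<in> ?V"
      using Suc i' by (intro single_mem_polys_le) (simp add: idx_le_def)
    have "Poly_Mapping.single i 1 = t k * ?f"
      by (simp add: t_def mult_single i'(1) add.commute)
    moreover have "?\<phi> (t k * ?f) = T k (?\<phi> ?f)"
      unfolding T_def moment_vec_eq_iff
    proof
      fix v assume "v \<in> ?V"
      then show "?L (t k * ?f * v) = ?L (t k * \<sigma> (?\<phi> ?f) * v)"
        using key[OF VW[OF f] tW, of v k] by (simp add: mult_ac)
    qed
    ultimately have "B (?\<phi> (Poly_Mapping.single i 1)) u = ev u k * B (?\<phi> ?f) u"
      by (simp add: adj ev[OF that(1)] bilinear_rmul[OF bil])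
    also have "B (?\<phi> ?f) u = idx_pow (pt u) i' * c u"
      using Suc i' by simp
    finally show ?case
      by (simp add: i'(1) idx_pow_add pt_def del: One_nat_def)
  qed
  have coord: "B (?\<phi> f) u = mpoly_eval f (pt u) * c u" if f: "f \<in> ?W" and u: "u \<in> U" for f u
  proof -
    have lin: "linear (\<lambda>f. B (?\<phi> f) u)"
      using linear_compose[OF linear_moment_vec, of "\<lambda>x. B x u"] bil by (simp add: bilinear_def o_def)
    have "B (?\<phi> f) u = (\<Sum>i\<in>idx_le (l + 1). Poly_Mapping.lookup f i * (idx_pow (pt u) i * c u))"
      by (subst polys_le_expand[OF f])
         (simp add: linear_sum[OF lin] linear_cmul[OF lin] coord_monom[OF u] idx_le_def)
    also have "\<dots> = mpoly_eval f (pt u) * c u"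
      by (simp add: mpoly_eval_expand[OF f] sum_distrib_right mult.assoc)
    finally show ?thesis .
  qed
  \<comment> \<open>Parseval's identity in the basis \<open>U\<close>; it exhibits
    \<open>(c u)\<^sup>2\<close> as the weight of the atom \<open>pt u\<close>.\<close>
  have L_eq: "?L (f * g) = (\<Sum>u\<in>U. (c u)\<^sup>2 * mpoly_eval (f * g) (pt u))" if f: "f \<in> ?W" and g: "g \<in> ?W" for f g
  proof -
    have "?L (f * g) = B (?\<phi> f) (?\<phi> g)"
      using key[OF f VW[OF \<sigma>V]] key'[OF g f] by (simp add: B_def)
    also have "\<dots> = (\<Sum>u\<in>U. B (?\<phi> g) u * B (?\<phi> f) u)"
      using bil
      by (subst expand[OF HW[OF g]])
         (simp add: bilinear_def linear_sum[of "B (?\<phi> f)"] linear_cmul[of "B (?\<phi> f)"])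
    also have "\<dots> = (\<Sum>u\<in>U. (c u)\<^sup>2 * mpoly_eval (f * g) (pt u))"
      by (intro sum.cong refl) (simp add: coord[OF f] coord[OF g] mpoly_eval_mult power2_eq_square)
    finally show ?thesis .
  qed
  \<comment> \<open>\<open>coord\<close> applied to the representative of an eigenvector. It follows
    that all \<open>c u\<close> are nonzero, that the atoms are distinct, and that
    \<open>c u *\<^sub>R \<sigma> u\<close> interpolates at them.\<close>
  have dual: "mpoly_eval (\<sigma> u) (pt w) * c w = (if u = w then 1 else 0)" if "u \<in> U" "w \<in> U" for u w
    using coord[OF VW[OF \<sigma>V], of w u] orth[OF that] \<sigma>(3)[of u] U(2) that by (auto simp: H_def)
  have c0: "c u \<noteq> 0" if "u \<in> U" for u
    using dual[OF that that] by auto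
  have inj: "inj_on pt U"
  proof (rule inj_onI, rule ccontr)
    fix u w assume uw: "u \<in> U" "w \<in> U" "pt u = pt w" "u \<noteq> w"
    then have "mpoly_eval (\<sigma> u) (pt u) = 0"
      using dual[OF uw(1,2)] c0[OF uw(2)] by simp
    then show False using dual[OF uw(1,1)] by simp
  qed
  define \<rho> where "\<rho> x = (c (inv_into U pt x))\<^sup>2" for x
  have \<rho>: "\<rho> (pt u) = (c u)\<^sup>2" if "u \<in> U" for u
    using that inj by (simp add: \<rho>_def)
  show thesis
  proof (rule that[of "pt ` U" \<rho>])
    show "finite (pt ` U)" using U(1) by simp
    show "\<rho> x > 0" if "x \<in> pt ` U" for x
      using that c0 \<rho> by auto
    show "\<delta> i = (\<Sum>x\<in>pt ` U. \<rho> x * idx_pow x i)" if i: "i \<in> idx_le (2 * (l + 1))" for i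
    proof -
      \<comment> \<open>\<open>L_eq\<close> speaks of products, so a monomial of degree up to
        \<open>2 * (l + 1)\<close> is split into two of degree at most \<open>l + 1\<close>.\<close>
      have "\<exists>j k. i = j + k \<and> idx_deg j \<le> l + 1 \<and> idx_deg k \<le> l + 1"
      proof (cases "idx_deg i \<le> l + 1")
        case True
        then show ?thesis by (intro exI[of _ i] exI[of _ 0]) simp
      next
        case False
        then obtain j k where "i = j + k" "idx_deg j = l + 1" "idx_deg k = idx_deg i - (l + 1)"
          using idx_deg_splitE[of i "l + 1" "idx_deg i - (l + 1)"] by auto
        moreover have "idx_deg i \<le> 2 * (l + 1)"
          using i by (simp add: idx_le_def)
        ultimately show ?thesis
          by (intro exI[of _ j] exI[of _ k]) auto
      qed
      then obtain j k where jk: "i = j + k" "idx_deg j \<le> l + 1" "idx_deg k \<le> l + 1"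
        by blast
      have "Poly_Mapping.single j 1 \<in> ?W" "Poly_Mapping.single k 1 \<in> ?W"
        using jk by (auto intro!: single_mem_polys_le simp: idx_le_def)
      from L_eq[OF this] have "\<delta> i = (\<Sum>u\<in>U. (c u)\<^sup>2 * idx_pow (pt u) i)"
        by (simp add: mult_single jk(1))
      then show ?thesis
        by (simp add: sum.reindex[OF inj] \<rho>)
    qed
    show "\<exists>f\<in>polys_le l. \<forall>y\<in>pt ` U. mpoly_eval f y = (if y = x then 1 else 0)" if x: "x \<in> pt ` U" for x
    proof -
      obtain u where u: "u \<in> U" "x = pt u" using x by auto
      have "mpoly_eval (c u *\<^sub>R \<sigma> u) (pt w) = (if pt w = x then 1 else 0)" if "w \<in> U" for w
      proof (cases "w = u")
        case True
        then show ?thesis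
          using dual[OF u(1) u(1)] u by (simp add: linear_cmul[OF linear_mpoly_eval] mult.commute)
      next
        case False
        then have "pt w \<noteq> x" using inj u that by (auto dest: inj_onD)
        then show ?thesis
          using dual[OF u(1) that] False c0[OF that] by (simp add: linear_cmul[OF linear_mpoly_eval])
      qed
      then show ?thesis
        using polys_le_scale[OF \<sigma>V] by blast
    qed
  qed
qed

section \<open>Caratheodory reduction and interpolation\<close>

text \<open>Stars and bars: the slack entry \<open>d - idx_deg i\<close> turns a multi-index into a
  list of \<open>N + 1\<close> naturals with sum exactly \<open>d\<close>.\<close>

lemma card_idx_le: "card (idx_le d :: (nat ^ 'n::finite) set) \<le> (d + CARD('n)) choose CARD('n)"
proof -
  obtain h where h: "bij_betw h {..<CARD('n)} (UNIV :: 'n set)"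
    using ex_bij_betw_nat_finite[of "UNIV :: 'n set"] by (auto simp: atLeast0LessThan)
  define F where "F i = (d - idx_deg i) # map (\<lambda>m. i $ h m) [0..<CARD('n)]" for i :: "nat ^ 'n"
  have inj: "inj_on F (idx_le d)"
  proof (rule inj_onI)
    fix i j assume "F i = F j"
    then have eq: "i $ h m = j $ h m" if "m < CARD('n)" for m
      using that by (auto simp: F_def)
    have "i $ k = j $ k" for k
      using h eq[of "inv_into {..<CARD('n)} h k"] bij_betw_inv_into_right[OF h, of k]
        bij_betw_apply[OF bij_betw_inv_into[OF h], of k] by simp
    then show "i = j" by (simp add: vec_eq_iff)
  qed
  have sub: "F ` idx_le d \<subseteq> {xs. length xs = Suc CARD('n) \<and> sum_list xs = d}"
  proof
    fix xs assume "xs \<in> F ` idx_le d"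
    then obtain i where i: "idx_deg i \<le> d" "xs = F i" by (auto simp: idx_le_def)
    have "sum_list (map (\<lambda>m. i $ h m) [0..<CARD('n)]) = (\<Sum>m<CARD('n). i $ h m)"
      by (simp add: interv_sum_list_conv_sum_set_nat atLeast0LessThan)
    also have "\<dots> = idx_deg i"
      unfolding idx_deg_def by (rule sum.reindex_bij_betw[OF h])
    finally show "xs \<in> {xs. length xs = Suc CARD('n) \<and> sum_list xs = d}"
      using i by (simp add: F_def)
  qed
  have card: "card {xs::nat list. length xs = Suc CARD('n) \<and> sum_list xs = d}
      = (d + CARD('n)) choose CARD('n)"
    using card_length_sum_list[of "Suc CARD('n)" d] binomial_symmetric[of d "d + CARD('n)"] by simp
  have fin: "finite {xs::nat list. length xs = Suc CARD('n) \<and> sum_list xs = d}"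
    by (rule card_ge_0_finite, unfold card) simp
  show ?thesis
    using card_inj_on_le[OF inj sub fin] unfolding card .
qed

text \<open>The powers of a single variable already give \<open>d + 1\<close> indices. For
  \<open>d = 2n\<close> this ensures that level \<open>2D\<close> of the theorem is not below
  \<open>n\<close>.\<close>

lemma le_card_idx_le: "d < card (idx_le d :: (nat ^ 'n::finite) set)"
proof -
  fix k :: 'n
  have "(\<lambda>c. axis k c) ` {..d} \<subseteq> (idx_le d :: (nat ^ 'n) set)"
    by (auto simp: idx_le_def)
  moreover have "inj_on (\<lambda>c. axis k c :: nat ^ 'n) {..d}"
    by (auto simp: inj_on_def axis_eq_axis)
  ultimately have "card {..d} \<le> card (idx_le d :: (nat ^ 'n) set)"
    by (intro card_inj_on_le) auto
  then show ?thesis by simp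
qed

text \<open>With more atoms than monomials, the monomial vectors of the atoms are dependent.
  Shifting the weights along the relation preserves the moments, and stopping when a first weight
  reaches zero removes an atom.\<close>

lemma caratheodory_atoms:
  fixes S :: "(real ^ 'n::finite) set"
  assumes "finite S" "\<And>x. x \<in> S \<Longrightarrow> \<rho> x > 0"
  shows "\<exists>S' \<rho>'. S' \<subseteq> S \<and> (\<forall>x\<in>S'. \<rho>' x > 0) \<and> card S' \<le> card (idx_le d :: (nat ^ 'n) set) \<and>
    (\<forall>i\<in>idx_le d. (\<Sum>x\<in>S'. \<rho>' x * idx_pow x i) = (\<Sum>x\<in>S. \<rho> x * idx_pow x i))"
  using assms
proof (induction "card S" arbitrary: S \<rho> rule: less_induct)
  case less
  let ?I = "idx_le d :: (nat ^ 'n) set"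
  let ?F = "(\<lambda>i. Poly_Mapping.single i (1::real)) ` ?I"
  show ?case
  proof (cases "card S \<le> card ?I")
    case True
    then show ?thesis using less.prems by blast
  next
    case False
    define v where "v x = (\<Sum>i\<in>?I. idx_pow x i *\<^sub>R Poly_Mapping.single i (1::real))" for x :: "real ^ 'n"
    have "v ` S \<subseteq> span ?F"
      unfolding v_def by (intro image_subsetI span_sum span_scale span_base imageI)
    moreover have "card ?F < card S"
      using False card_image_le[of ?I "\<lambda>i. Poly_Mapping.single i (1::real)"] by simp
    moreover have "finite ?F" by simp
    ultimately obtain c0 where c0: "\<exists>x\<in>S. c0 x \<noteq> 0" "(\<Sum>x\<in>S. c0 x *\<^sub>R v x) = 0"
      using nontrivial_relation[of ?F S v] less.prems(1) by blast
    \<comment> \<open>The sign is chosen so that some coefficient is positive and hence some weight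
      decreases.\<close>
    define c where "c = (if \<exists>x\<in>S. c0 x > 0 then c0 else (\<lambda>x. - c0 x))"
    have cv: "(\<Sum>x\<in>S. c x *\<^sub>R v x) = 0"
      using c0(2) by (simp add: c_def sum_negf)
    have "\<exists>x\<in>S. c x > 0"
    proof (cases "\<exists>x\<in>S. c0 x > 0")
      case False
      then have "c = (\<lambda>x. - c0 x)"
        unfolding c_def by (rule if_not_P)
      moreover have "\<exists>x\<in>S. c0 x < 0"
        using c0(1) False by (meson linorder_neqE_linordered_idom)
      ultimately show ?thesis by simp
    qed (simp add: c_def)
    have lookup_v: "Poly_Mapping.lookup (v x) i = idx_pow x i" if "i \<in> ?I" for x i
      using that by (simp add: v_def lookup_sum lookup_single when_def if_distrib cong: if_cong)
    have c_mom: "(\<Sum>x\<in>S. c x * idx_pow x i) = 0" if "i \<in> ?I" for i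
      using arg_cong[OF cv, of "\<lambda>p. Poly_Mapping.lookup p i"] that by (simp add: lookup_sum lookup_v)
    define P where "P = {x \<in> S. c x > 0}"
    \<comment> \<open>The largest shift that keeps all weights nonnegative; a minimising
      \<open>x0\<close> loses its weight. Weights outside \<open>P\<close> do not decrease.\<close>
    define \<theta> where "\<theta> = Min ((\<lambda>x. \<rho> x / c x) ` P)"
    have P: "finite P" "P \<noteq> {}"
      using less.prems(1) \<open>\<exists>x\<in>S. c x > 0\<close> by (auto simp: P_def)
    then have "\<theta> \<in> (\<lambda>x. \<rho> x / c x) ` P"
      unfolding \<theta>_def by (intro Min_in) auto
    then obtain x0 where x0: "x0 \<in> P" "\<theta> = \<rho> x0 / c x0" by auto
    have \<theta>0: "\<theta> > 0"
      using x0 less.prems(2) by (auto simp: P_def)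
    define \<rho>1 where "\<rho>1 x = \<rho> x - \<theta> * c x" for x
    have nonneg: "\<rho>1 x \<ge> 0" if "x \<in> S" for x
    proof (cases "c x > 0")
      case True
      then have "\<theta> \<le> \<rho> x / c x"
        unfolding \<theta>_def using P that by (intro Min_le) (auto simp: P_def)
      then show ?thesis using True by (simp add: \<rho>1_def field_simps)
    next
      case False
      then have "\<theta> * c x \<le> 0"
        using \<theta>0 by (simp add: mult_nonneg_nonpos)
      then show ?thesis using less.prems(2)[OF that] by (simp add: \<rho>1_def)
    qed
    define S1 where "S1 = {x \<in> S. \<rho>1 x > 0}"
    have "x0 \<in> S" "x0 \<notin> S1"
      using x0 by (auto simp: P_def S1_def \<rho>1_def)
    then have "S1 \<subset> S" by (auto simp: S1_def)
    then have "card S1 < card S"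
      using less.prems(1) by (rule psubset_card_mono[rotated])
    moreover have "finite S1" "\<And>x. x \<in> S1 \<Longrightarrow> \<rho>1 x > 0"
      using less.prems(1) by (auto simp: S1_def)
    ultimately obtain S' \<rho>' where S': "S' \<subseteq> S1" "\<forall>x\<in>S'. \<rho>' x > 0" "card S' \<le> card ?I"
      "\<forall>i\<in>?I. (\<Sum>x\<in>S'. \<rho>' x * idx_pow x i) = (\<Sum>x\<in>S1. \<rho>1 x * idx_pow x i)"
      using less.hyps[of S1 \<rho>1] by blast
    have "(\<Sum>x\<in>S1. \<rho>1 x * idx_pow x i) = (\<Sum>x\<in>S. \<rho> x * idx_pow x i)" if "i \<in> ?I" for i
    proof -
      have "(\<Sum>x\<in>S1. \<rho>1 x * idx_pow x i) = (\<Sum>x\<in>S. \<rho>1 x * idx_pow x i)"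
        using less.prems(1) nonneg
        by (intro sum.mono_neutral_left) (force simp: S1_def)+
      also have "\<dots> = (\<Sum>x\<in>S. \<rho> x * idx_pow x i) - \<theta> * (\<Sum>x\<in>S. c x * idx_pow x i)"
        by (simp add: \<rho>1_def left_diff_distrib sum_subtractf sum_distrib_left mult.assoc)
      finally show ?thesis using c_mom[OF that] by simp
    qed
    then show ?thesis
      using S' \<open>S1 \<subset> S\<close> by (intro exI[of _ S'] exI[of _ \<rho>']) auto
  qed
qed

lemma mpoly_eval_1 [simp]: "mpoly_eval 1 x = 1"
  using mpoly_eval_single[of 0 1 x] by simp

text \<open>One affine factor \<open>(t_k - z_k) / (x_k - z_k)\<close> per point \<open>z\<close>,
  where \<open>k\<close> is a coordinate separating \<open>x\<close> from \<open>z\<close>.\<close>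

lemma vanishing_polynomial:
  fixes x :: "real ^ 'n::finite"
  assumes "finite T" "x \<notin> T"
  shows "\<exists>f\<in>polys_le (card T). mpoly_eval f x = 1 \<and> (\<forall>y\<in>T. mpoly_eval f y = 0)"
  using assms
proof (induction T rule: finite_induct)
  case empty
  show ?case
    by (intro bexI[of _ "Poly_Mapping.single 0 1"] conjI single_mem_polys_le) auto
next
  case (insert z T)
  then obtain f where f: "f \<in> polys_le (card T)" "mpoly_eval f x = 1" "\<forall>y\<in>T. mpoly_eval f y = 0"
    by auto
  obtain k where k: "x $ k \<noteq> z $ k"
    using insert.prems by (auto simp: vec_eq_iff)
  define g where "g = (1 / (x $ k - z $ k)) *\<^sub>R
    (Poly_Mapping.single (axis k (1::nat)) (1::real) - Poly_Mapping.single 0 (z $ k))"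
  have "g \<in> polys_le 1"
    unfolding g_def by (intro polys_le_scale polys_le_diff single_mem_polys_le) (auto simp: idx_le_def)
  then have "f * g \<in> polys_le (card (insert z T))"
    using mult_mem_polys_le[OF f(1), of g 1] insert.hyps by simp
  moreover have "mpoly_eval g y = (y $ k - z $ k) / (x $ k - z $ k)" for y
    by (simp add: g_def linear_cmul[OF linear_mpoly_eval] linear_diff[OF linear_mpoly_eval] del: One_nat_def)
  ultimately show ?case
    using f k by (intro bexI[of _ "f * g"]) (auto simp: mpoly_eval_mult)
qed

lemma interpolation:
  fixes S :: "(real ^ 'n::finite) set"
  assumes "finite S" "card S \<le> Suc d" "x \<in> S"
  shows "\<exists>f\<in>polys_le d. \<forall>y\<in>S. mpoly_eval f y = (if y = x then 1 else 0)"
proof -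
  obtain f where f: "f \<in> polys_le (card (S - {x}))" "mpoly_eval f x = 1" "\<forall>y\<in>S - {x}. mpoly_eval f y = 0"
    using vanishing_polynomial[of "S - {x}" x] assms(1) by auto
  have "card (S - {x}) \<le> d" using assms by simp
  then show ?thesis
    using f polys_le_mono[of "card (S - {x})" d] by (intro bexI[of _ f]) auto
qed

section \<open>Finitely atomic measures\<close>

text \<open>\<open>point_measure\<close> lives on the power set of \<open>S\<close>; the
  push-forward along the identity makes it a Borel measure on the whole space.\<close>

definition atomic_measure :: "(real ^ 'n::finite) set \<Rightarrow> (real ^ 'n \<Rightarrow> real) \<Rightarrow> (real ^ 'n) measure" where
  "atomic_measure S \<rho> = distr (point_measure S (\<lambda>x. ennreal (\<rho> x))) borel (\<lambda>x. x)"

lemma sets_atomic_measure [simp]: "sets (atomic_measure S \<rho>) = sets borel"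
  by (simp add: atomic_measure_def)

lemma emeasure_atomic_measure:
  assumes "finite S" "A \<in> sets borel"
  shows "emeasure (atomic_measure S \<rho>) A = (\<Sum>x\<in>S. ennreal (\<rho> x) * indicator A x)"
proof -
  have "emeasure (atomic_measure S \<rho>) A = emeasure (point_measure S (\<lambda>x. ennreal (\<rho> x))) (S \<inter> A)"
    unfolding atomic_measure_def
    using assms(2) by (subst emeasure_distr) (auto simp: space_point_measure Int_commute)
  also have "\<dots> = (\<Sum>x\<in>S \<inter> A. ennreal (\<rho> x))"
    using assms(1) by (simp add: emeasure_point_measure_finite)
  also have "\<dots> = (\<Sum>x\<in>S. ennreal (\<rho> x) * indicator A x)"
    using assms(1) by (intro sum.mono_neutral_cong_left) (auto simp: indicator_def)
  finally show ?thesis .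
qed

lemma finitely_atomic_atomic_measure:
  assumes "finite S" "\<And>x. x \<in> S \<Longrightarrow> \<rho> x > 0"
  shows "finitely_atomic (atomic_measure S \<rho>)"
  unfolding finitely_atomic_def using assms emeasure_atomic_measure by blast

lemma finitely_atomicE:
  assumes "finitely_atomic \<mu>" "sets \<mu> = sets borel"
  obtains S \<rho> where "finite S" "\<And>x. x \<in> S \<Longrightarrow> \<rho> x > 0" "\<mu> = atomic_measure S \<rho>"
proof -
  obtain S \<rho> where S: "finite S" "\<forall>x\<in>S. \<rho> x > 0"
    "\<forall>A\<in>sets borel. emeasure \<mu> A = (\<Sum>x\<in>S. ennreal (\<rho> x) * indicator A x)"
    using assms(1) unfolding finitely_atomic_def by blast
  have "\<mu> = atomic_measure S \<rho>"
    using assms(2) S by (intro measure_eqI) (auto simp: emeasure_atomic_measure)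
  then show thesis using that S by blast
qed

lemma measurable_idx_pow [measurable]: "(\<lambda>t. idx_pow t i) \<in> borel_measurable borel"
  unfolding idx_pow_def by (intro borel_measurable_continuous_onI continuous_intros)

lemma representing_atomic_measure_iff:
  assumes "finite S" "\<And>x. x \<in> S \<Longrightarrow> \<rho> x > 0"
  shows "representing_measure d \<beta> (atomic_measure S \<rho>) \<longleftrightarrow>
    (\<forall>i\<in>idx_le d. \<beta> i = (\<Sum>x\<in>S. \<rho> x * idx_pow x i))"
proof -
  have m: "(\<lambda>x. x) \<in> measurable (point_measure S (\<lambda>x. ennreal (\<rho> x))) borel"
    by simp
  have "integrable (atomic_measure S \<rho>) (\<lambda>t. idx_pow t i)" for i
    unfolding atomic_measure_def using assms(1)
    by (subst integrable_distr_eq[OF m]) (auto intro: integrable_point_measure_finite)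
  moreover have "(\<integral>t. idx_pow t i \<partial>atomic_measure S \<rho>) = (\<Sum>x\<in>S. \<rho> x * idx_pow x i)" for i
    unfolding atomic_measure_def using assms
    by (subst integral_distr[OF m]) (auto simp: lebesgue_integral_point_measure_finite less_imp_le)
  ultimately show ?thesis
    by (simp add: representing_measure_def)
qed

lemma measure_supp_atomic_measure:
  assumes S: "finite S" "\<And>x. x \<in> S \<Longrightarrow> \<rho> x > 0"
  shows "measure_supp (atomic_measure S \<rho>) = S"
proof (intro antisym subsetI)
  fix x assume x: "x \<in> measure_supp (atomic_measure S \<rho>)"
  show "x \<in> S"
  proof (rule ccontr)
    assume "x \<notin> S"
    moreover have "open (- S)"
      using S(1) by (simp add: finite_imp_closed open_Compl)
    ultimately have "emeasure (atomic_measure S \<rho>) (- S) > 0"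
      using x by (auto simp: measure_supp_def)
    then show False
      using S(1) \<open>open (- S)\<close> by (simp add: emeasure_atomic_measure)
  qed
next
  fix x assume x: "x \<in> S"
  have "emeasure (atomic_measure S \<rho>) U > 0" if "open U" "x \<in> U" for U
  proof -
    have "0 < ennreal (\<rho> x) * indicator U x"
      using S(2)[OF x] that by simp
    also have "\<dots> \<le> (\<Sum>y\<in>S. ennreal (\<rho> y) * indicator U y)"
      using S(1) x by (intro member_le_sum) auto
    finally show ?thesis
      using S(1) that by (simp add: emeasure_atomic_measure)
  qed
  then show "x \<in> measure_supp (atomic_measure S \<rho>)"
    by (auto simp: measure_supp_def)
qed

section \<open>Moment and localizing matrices of finitely atomic measures\<close>

lemma riesz_quadratic_form:
  fixes p :: "('n::finite, real) mpoly"
  assumes "finite I"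
  shows "riesz \<omega> (p * ((\<Sum>i\<in>I. Poly_Mapping.single i (a i)) * (\<Sum>i\<in>I. Poly_Mapping.single i (a i))))
    = (\<Sum>i\<in>I. \<Sum>j\<in>I. riesz \<omega> (p * Poly_Mapping.single (i + j) 1) * a j * a i)"
proof -
  have "p * Poly_Mapping.single (i + j) (a i * a j) = (a i * a j) *\<^sub>R (p * Poly_Mapping.single (i + j) 1)" for i j
    by (simp flip: mpoly_mult_scaleR_right add: scaleR_single)
  then have "riesz \<omega> (p * (Poly_Mapping.single i (a i) * Poly_Mapping.single j (a j)))
      = riesz \<omega> (p * Poly_Mapping.single (i + j) 1) * a j * a i" for i j
    by (simp add: mult_single mult_ac)
  then show ?thesis
    unfolding sum_product by (simp add: sum_distrib_left riesz_sum)
qed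

text \<open>The quadratic form at the coefficients of \<open>f\<close> is the functional at
  \<open>p * (f * f)\<close>, and symmetry holds as entries depend on \<open>i + j\<close> only.
  Moment matrices are the case \<open>p = 1\<close>.\<close>

lemma mat_psd_riesz_iff:
  "mat_psd (idx_le l) (\<lambda>i j. if i \<in> idx_le l \<and> j \<in> idx_le l
      then riesz \<omega> (p * Poly_Mapping.single (i + j) 1) else 0) \<longleftrightarrow>
    (\<forall>f\<in>polys_le l. riesz \<omega> (p * (f * f)) \<ge> 0)" (is "?lhs \<longleftrightarrow> ?rhs")
proof -
  have "?lhs \<longleftrightarrow> (\<forall>a. riesz \<omega> (p * ((\<Sum>i\<in>idx_le l. Poly_Mapping.single i (a i)) *
      (\<Sum>i\<in>idx_le l. Poly_Mapping.single i (a i)))) \<ge> 0)"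
    unfolding riesz_quadratic_form[OF finite_idx_le] mat_psd_def by (simp add: add.commute)
  also have "\<dots> \<longleftrightarrow> ?rhs"
  proof
    assume *: "\<forall>a. riesz \<omega> (p * ((\<Sum>i\<in>idx_le l. Poly_Mapping.single i (a i)) *
      (\<Sum>i\<in>idx_le l. Poly_Mapping.single i (a i)))) \<ge> 0"
    show ?rhs
    proof
      fix f :: "('a, real) mpoly" assume "f \<in> polys_le l"
      then have "f = (\<Sum>i\<in>idx_le l. Poly_Mapping.single i (Poly_Mapping.lookup f i))"
        by (intro poly_mapping_decompose) (auto simp: polys_le_def)
      then show "riesz \<omega> (p * (f * f)) \<ge> 0"
        using *[rule_format, of "Poly_Mapping.lookup f"] by simp
    qed
  next
    assume ?rhs
    moreover have "(\<Sum>i\<in>idx_le l. Poly_Mapping.single i (a i)) \<in> polys_le l" for a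
      by (intro polys_le_sum single_mem_polys_le)
    ultimately show "\<forall>a. riesz \<omega> (p * ((\<Sum>i\<in>idx_le l. Poly_Mapping.single i (a i)) *
      (\<Sum>i\<in>idx_le l. Poly_Mapping.single i (a i)))) \<ge> 0"
      by blast
  qed
  finally show ?thesis .
qed

lemma mat_psd_moment_matrix_iff:
  "mat_psd (idx_le l) (moment_matrix l \<omega>) \<longleftrightarrow> (\<forall>f\<in>polys_le l. riesz \<omega> (f * f) \<ge> 0)"
proof -
  have "moment_matrix l \<omega> = (\<lambda>i j. if i \<in> idx_le l \<and> j \<in> idx_le l
      then riesz \<omega> (1 * Poly_Mapping.single (i + j) 1) else 0)"
    by (simp add: moment_matrix_def fun_eq_iff)
  then show ?thesis
    using mat_psd_riesz_iff[of l \<omega> 1] by simp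
qed

lemma mat_psd_localizing_matrix_iff:
  "mat_psd (idx_le l) (localizing_matrix (l + (mpoly_deg p + 1) div 2) p \<omega>) \<longleftrightarrow>
    (\<forall>f\<in>polys_le l. riesz \<omega> (p * (f * f)) \<ge> 0)"
proof -
  have "localizing_matrix (l + (mpoly_deg p + 1) div 2) p \<omega> = (\<lambda>i j. if i \<in> idx_le l \<and> j \<in> idx_le l
      then riesz \<omega> (p * Poly_Mapping.single (i + j) 1) else 0)"
    by (simp add: fun_eq_iff localizing_matrix_eq)
  then show ?thesis
    using mat_psd_riesz_iff[of l \<omega> p] by simp
qed

lemma mem_polys_le_deg: "p \<in> polys_le (mpoly_deg p)"
  using keys_subset_idx_le[of p "mpoly_deg p"] by (simp add: polys_le_def)

lemma riesz_atomic_moments: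
  "riesz (\<lambda>i. \<Sum>x\<in>S. \<rho> x * idx_pow x i) p = (\<Sum>x\<in>S. \<rho> x * mpoly_eval p x)"
  by (rule riesz_atomic[OF refl mem_polys_le_deg])

text \<open>Interpolation in degree \<open>l\<close> gives every \<open>M(r)\<close> with
  \<open>r \<ge> l\<close> the rank \<open>card S\<close>, so the rank never changes from there
  on.\<close>

lemma flat_extension_atomic_moments:
  fixes S :: "(real ^ 'n::finite) set" and \<rho> :: "real ^ 'n \<Rightarrow> real"
  defines "\<omega> \<equiv> \<lambda>i. \<Sum>x\<in>S. \<rho> x * idx_pow x i"
  assumes S: "finite S" "\<And>x. x \<in> S \<Longrightarrow> \<rho> x > 0"
    and interp: "\<And>x. x \<in> S \<Longrightarrow> \<exists>f\<in>polys_le l. \<forall>y\<in>S. mpoly_eval f y = (if y = x then 1 else 0)"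
    and "l \<le> s"
  shows "flat_extension s \<omega> \<omega>"
proof -
  have "moment_rank r \<omega> = card S" if "l \<le> r" for r
  proof (rule moment_rank_atomic[OF S])
    show "\<exists>f\<in>polys_le r. \<forall>y\<in>S. mpoly_eval f y = (if y = x then 1 else 0)" if "x \<in> S" for x
      using interp[OF that] polys_le_mono[OF \<open>l \<le> r\<close>] by blast
  qed (simp_all add: \<omega>_def)
  then show ?thesis
    using \<open>l \<le> s\<close> by (simp add: flat_extension_def moment_extension_def)
qed

section \<open>Equivalence of atomic measures in \<open>K_set m q\<close> and flat
  extensions\<close>

theorem corollary1p4:
  fixes \<beta> :: "nat ^ 'n::finite \<Rightarrow> real"
    and q :: "nat \<Rightarrow> ('n, real) mpoly"
    and k :: "nat \<Rightarrow> nat"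
    and n m :: nat
  assumes "\<And>i. i \<in> {1..m} \<Longrightarrow> mpoly_deg (q i) = 2 * k i \<or> mpoly_deg (q i) + 1 = 2 * k i"
  shows "(\<exists>\<mu> :: (real ^ 'n) measure.
            representing_measure (2 * n) \<beta> \<mu> \<and> finitely_atomic \<mu> \<and> measure_supp \<mu> \<subseteq> K_set m q)
     \<longleftrightarrow>
         (\<exists>(j::nat) (\<gamma> :: nat ^ 'n \<Rightarrow> real) (\<delta> :: nat ^ 'n \<Rightarrow> real).
            n + j \<le> 2 * ((2 * n + CARD('n)) choose CARD('n)) \<and>
            moment_extension n \<beta> (n + j) \<gamma> \<and>
            mat_psd (idx_le (n + j)) (moment_matrix (n + j) \<gamma>) \<and>
            flat_extension (n + j) \<gamma> \<delta> \<and>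
            (\<forall>i\<in>{1..m}. mat_psd (idx_le (n + j))
               (localizing_matrix (n + j + k i) (q i) (flat_completion (n + j + 1) \<delta>))))"
    (is "?lhs \<longleftrightarrow> ?rhs")
proof -
  have k: "k i = (mpoly_deg (q i) + 1) div 2" if "i \<in> {1..m}" for i
    using assms[OF that] by auto
  let ?mom = "\<lambda>S \<rho> i. \<Sum>x\<in>S. \<rho> x * idx_pow x i"
  show ?thesis
  proof
    assume ?lhs
    then obtain \<mu> :: "(real ^ 'n) measure" where \<mu>: "representing_measure (2 * n) \<beta> \<mu>"
      "finitely_atomic \<mu>" "measure_supp \<mu> \<subseteq> K_set m q"
      by blast
    obtain S0 \<rho>0 where S0: "finite S0" "\<And>x. x \<in> S0 \<Longrightarrow> \<rho>0 x > 0" "\<mu> = atomic_measure S0 \<rho>0"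
      using finitely_atomicE \<mu>(1,2) unfolding representing_measure_def by blast
    have \<beta>: "\<forall>i\<in>idx_le (2 * n). \<beta> i = ?mom S0 \<rho>0 i"
      using \<mu>(1) S0 representing_atomic_measure_iff by blast
    have K0: "S0 \<subseteq> K_set m q"
      using \<mu>(3) S0 measure_supp_atomic_measure by blast
    obtain S \<rho> where S: "S \<subseteq> S0" "\<forall>x\<in>S. \<rho> x > 0" "card S \<le> card (idx_le (2 * n) :: (nat ^ 'n) set)"
      "\<forall>i\<in>idx_le (2 * n). ?mom S \<rho> i = ?mom S0 \<rho>0 i"
      using caratheodory_atoms[where d = "2 * n" and \<rho> = \<rho>0, OF S0(1)] S0(2) by blast
    have S': "finite S" "\<And>x. x \<in> S \<Longrightarrow> \<rho> x > 0"
      using S S0(1) finite_subset by auto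
    define \<omega> where "\<omega> = ?mom S \<rho>"
    define D where "D = (2 * n + CARD('n)) choose CARD('n)"
    have D: "n \<le> 2 * D" "card S \<le> Suc (2 * D)"
      using le_card_idx_le[where 'n = 'n, of "2 * n"] card_idx_le[where 'n = 'n, of "2 * n"] S(3)
      unfolding D_def by linarith+
    have flat: "flat_extension s \<omega> \<omega>" if "2 * D \<le> s" for s
      unfolding \<omega>_def
      using S' that D(2) by (intro flat_extension_atomic_moments[where l = "2 * D"] interpolation) auto
    have comp: "flat_completion (2 * D + 1) \<omega> = \<omega>"
      using flat by (intro flat_completion_eq[OF flat[OF order_refl]]) (auto simp: moment_extension_def)
    have psd: "riesz \<omega> (f * f) \<ge> 0" for f :: "('n, real) mpoly"
      unfolding \<omega>_def riesz_atomic_moments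
      using S' by (intro sum_nonneg) (simp add: mpoly_eval_mult less_imp_le)
    have loc: "riesz \<omega> (q i * (f * f)) \<ge> 0" if "i \<in> {1..m}" for i f
      unfolding \<omega>_def riesz_atomic_moments
    proof (intro sum_nonneg)
      fix x assume x: "x \<in> S"
      then have "mpoly_eval (q i) x \<ge> 0"
        using S(1) K0 that by (auto simp: K_set_def)
      then show "\<rho> x * mpoly_eval (q i * (f * f)) x \<ge> 0"
        using S'(2)[OF x] by (simp add: mpoly_eval_mult less_imp_le)
    qed
    \<comment> \<open>The highest admissible level always works: \<open>j = 2D - n\<close>, with
      \<open>\<omega>\<close> serving as both \<open>\<gamma>\<close> and \<open>\<delta>\<close>.
      Here \<open>n \<le> 2D\<close> makes the truncated subtraction exact.\<close>
    have nD: "n + (2 * D - n) = 2 * D" using D(1) by simp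
    show ?rhs
      unfolding D_def[symmetric]
    proof (intro exI[of _ "2 * D - n"] exI[of _ \<omega>] conjI ballI, unfold nD comp)
      show "moment_extension n \<beta> (2 * D) \<omega>"
        using D(1) S(4) \<beta> by (simp add: moment_extension_def \<omega>_def)
      show "mat_psd (idx_le (2 * D)) (localizing_matrix (2 * D + k i) (q i) \<omega>)" if "i \<in> {1..m}" for i
        unfolding k[OF that] mat_psd_localizing_matrix_iff using loc[OF that] by blast
    qed (use psd flat in \<open>auto simp: mat_psd_moment_matrix_iff\<close>)
  next
    assume ?rhs
    then obtain j \<gamma> \<delta> where ext: "moment_extension n \<beta> (n + j) \<gamma>"
      and psd: "mat_psd (idx_le (n + j)) (moment_matrix (n + j) \<gamma>)"
      and flat: "flat_extension (n + j) \<gamma> \<delta>"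
      and loc: "\<forall>i\<in>{1..m}. mat_psd (idx_le (n + j))
               (localizing_matrix (n + j + k i) (q i) (flat_completion (n + j + 1) \<delta>))"
      by blast
    define l where "l = n + j"
    note ext = ext[folded l_def] and psd = psd[folded l_def] and flat = flat[folded l_def]
      and loc = loc[folded l_def]
    have \<delta>\<gamma>: "\<delta> i = \<gamma> i" if "i \<in> idx_le (2 * l)" for i
      using flat that by (simp add: flat_extension_def moment_extension_def)
    have psd\<delta>: "riesz \<delta> (f * f) \<ge> 0" if "f \<in> polys_le l" for f
    proof -
      have "f * f \<in> polys_le (2 * l)"
        using mult_mem_polys_le[OF that that] by (simp only: mult_2)
      then have "riesz \<delta> (f * f) = riesz \<gamma> (f * f)"
        unfolding riesz_def by (intro sum.cong refl) (auto simp: polys_le_def \<delta>\<gamma>)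
      then show ?thesis
        using psd that by (simp add: mat_psd_moment_matrix_iff)
    qed
    have red: "\<exists>p\<in>polys_le l. \<forall>g\<in>polys_le (l + 1). riesz \<delta> (f * g) = riesz \<delta> (p * g)"
      if "f \<in> polys_le (l + 1)" for f
      using flat_extension_reduce[OF flat that] by metis
    obtain S \<rho> where *: "finite S" "\<forall>x\<in>S. \<rho> x > 0"
      "\<forall>i\<in>idx_le (2 * (l + 1)). \<delta> i = ?mom S \<rho> i"
      "\<forall>x\<in>S. \<exists>f\<in>polys_le l. \<forall>y\<in>S. mpoly_eval f y = (if y = x then 1 else 0)"
      by (rule flat_extension_atomic[OF psd\<delta> red]) blast+
    then have S: "finite S" "\<And>x. x \<in> S \<Longrightarrow> \<rho> x > 0"
      and mom: "\<And>i. i \<in> idx_le (2 * (l + 1)) \<Longrightarrow> \<delta> i = ?mom S \<rho> i"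
      and interp: "\<And>x. x \<in> S \<Longrightarrow> \<exists>f\<in>polys_le l. \<forall>y\<in>S. mpoly_eval f y = (if y = x then 1 else 0)"
      by blast+
    \<comment> \<open>The moments of the measure agree with \<open>\<delta>\<close> up to degree
      \<open>2(l + 1)\<close> and are flat at every later level.\<close>
    have comp: "flat_completion (l + 1) \<delta> = ?mom S \<rho>"
      using mom by (intro flat_completion_eq[OF flat] flat_extension_atomic_moments[OF S interp])
        (auto simp: moment_extension_def)
    have loc': "\<forall>f\<in>polys_le l. riesz (?mom S \<rho>) (q i * (f * f)) \<ge> 0" if "i \<in> {1..m}" for i
      using loc[rule_format, OF that]
      by (simp only: comp k[OF that] mat_psd_localizing_matrix_iff)
    have "S \<subseteq> K_set m q"
      unfolding K_set_def
    proof safe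
      fix x i assume x: "x \<in> S" and i: "i \<in> {1..m}"
      \<comment> \<open>Testing the localizing form on this \<open>f\<close> leaves only the term
        \<open>\<rho> x * mpoly_eval (q i) x\<close>.\<close>
      obtain f where f: "f \<in> polys_le l" "\<forall>y\<in>S. mpoly_eval f y = (if y = x then 1 else 0)"
        using interp[OF x] by blast
      have "riesz (?mom S \<rho>) (q i * (f * f)) = (\<Sum>y\<in>S. if y = x then \<rho> x * mpoly_eval (q i) x else 0)"
        unfolding riesz_atomic_moments using f(2) by (intro sum.cong) (auto simp: mpoly_eval_mult)
      then have "\<rho> x * mpoly_eval (q i) x \<ge> 0"
        using loc'[OF i] f(1) S(1) x by force
      then show "mpoly_eval (q i) x \<ge> 0"
        using S(2)[OF x] by (simp add: zero_le_mult_iff)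
    qed
    moreover have "\<beta> i = ?mom S \<rho> i" if "i \<in> idx_le (2 * n)" for i
    proof -
      have i: "i \<in> idx_le (2 * l)" "i \<in> idx_le (2 * (l + 1))"
        using that by (auto simp: idx_le_def l_def)
      have "\<beta> i = \<gamma> i"
        using ext that by (simp add: moment_extension_def)
      also have "\<dots> = \<delta> i" using \<delta>\<gamma>[OF i(1)] by simp
      also have "\<dots> = ?mom S \<rho> i" by (rule mom[OF i(2)])
      finally show ?thesis .
    qed
    ultimately show ?lhs
      using S
      by (intro exI[of _ "atomic_measure S \<rho>"])
         (simp add: representing_atomic_measure_iff finitely_atomic_atomic_measure measure_supp_atomic_measure)
  qed
qed

end
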